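(* Let $X$ be a regular (Hausdorff) topological space which is an $L$-space (Lindelöf generated space) and whose dispersion character satisfies $\Delta(X)>\omega$. Then $X$ is resolvable.
   Context: All spaces are Hausdorff, and regular spaces are in particular Hausdorff. A subspace $P\subseteq X$ is Lindelöf if every cover of $P$ by open sets has a countable subcover. A topological space $X$ is an $L$-space (Lindelöf generated space) if a subset $A\subseteq X$ is closed in $X$ if and only if $A\cap P$ is closed in $P$ for every Lindelöf subspace $P\subseteq X$ (the subspaces $P$ are not required to be closed in $X$). The dispersion character $\Delta(X)$ is the smallest cardinality of a non-empty open subset of $X$. A space is resolvable if it is the union of two disjoint dense subsets. $\omega$ is the smallest infinite cardinal. *)

theory Defs
  imports "HOL-Analysis.Analysis"
begin

unbundle cardinal_syntax

(* The Lindelof subspaces P are arbitrary subsets of X, not necessarily closed ones. *)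
definition L_space :: "'a topology \<Rightarrow> bool" where
  "L_space X \<longleftrightarrow>
     (\<forall>A. A \<subseteq> topspace X \<longrightarrow>
        (closedin X A \<longleftrightarrow>
          (\<forall>P. P \<subseteq> topspace X \<and> Lindelof_space (subtopology X P) \<longrightarrow>
             closedin (subtopology X P) (A \<inter> P))))"

(* A cardinal is represented by a cardinal order, here that of an open set of least cardinality.
   The value is unspecified when X is empty. *)
definition dispersion_character :: "'a topology \<Rightarrow> 'a rel" where
  "dispersion_character X =
     |SOME U. openin X U \<and> U \<noteq> {} \<and> (\<forall>V. openin X V \<and> V \<noteq> {} \<longrightarrow> |U| \<le>o |V| )|"

definition dense_in :: "'a topology \<Rightarrow> 'a set \<Rightarrow> bool" where
  "dense_in X D \<longleftrightarrow> D \<subseteq> topspace X \<and> X closure_of D = topspace X"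

definition resolvable :: "'a topology \<Rightarrow> bool" where
  "resolvable X \<longleftrightarrow>
     (\<exists>D E. dense_in X D \<and> dense_in X E \<and> D \<inter> E = {} \<and> D \<union> E = topspace X)"

lemma dispersion_character_least:
  assumes "topspace X \<noteq> {}"
  shows "\<exists>U. openin X U \<and> U \<noteq> {} \<and> dispersion_character X = |U| \<and>
           (\<forall>V. openin X V \<and> V \<noteq> {} \<longrightarrow> |U| \<le>o |V| )"
proof -
  let ?R = "card_of ` {U. openin X U \<and> U \<noteq> {}}"
  have "?R \<noteq> {}" using assms openin_topspace by blast
  moreover have "\<forall>r\<in>?R. Card_order r" using card_of_Card_order by blast
  ultimately have "\<exists>r\<in>?R. \<forall>r'\<in>?R. r \<le>o r'" by (rule exists_minim_Card_order)
  then have "\<exists>U. openin X U \<and> U \<noteq> {} \<and> (\<forall>V. openin X V \<and> V \<noteq> {} \<longrightarrow> |U| \<le>o |V| )"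
    by auto
  from someI_ex[OF this] show ?thesis
    unfolding dispersion_character_def by blast
qed

lemma natLeq_less_dispersion_character_iff:
  assumes "topspace X \<noteq> {}"
  shows "natLeq <o dispersion_character X \<longleftrightarrow> (\<forall>U. openin X U \<and> U \<noteq> {} \<longrightarrow> uncountable U)"
proof -
  have unc: "natLeq <o |V| \<longleftrightarrow> uncountable V" for V :: "'a set"
  proof -
    have "countable V \<longleftrightarrow> |V| \<le>o |UNIV :: nat set|"
      unfolding countable_def card_of_ordLeq[symmetric] by auto
    also have "\<dots> \<longleftrightarrow> |V| \<le>o natLeq"
      using card_of_nat ordLeq_ordIso_trans ordIso_symmetric by blast
    finally show ?thesis
      using not_ordLeq_iff_ordLess[of natLeq "|V|"] natLeq_Well_order card_of_Well_order by blast
  qed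
  from dispersion_character_least[OF assms] obtain U where
    U: "openin X U" "U \<noteq> {}" "dispersion_character X = |U|"
       "\<And>V. openin X V \<Longrightarrow> V \<noteq> {} \<Longrightarrow> |U| \<le>o |V|" by blast
  show ?thesis
    unfolding U(3) using U(1,2,4) unc ordLess_ordLeq_trans by blast
qed

end

theory Submission
  imports Defs
begin

text \<open>
  A space is resolvable as soon as each non-empty open set contains a non-empty resolvable
  subspace. So suppose that some non-empty open set \<open>U\<close> is hereditarily irresolvable; the goal is to
  construct two disjoint sets in \<open>U\<close> that lie in each other's closure. Two devices produce such
  sets.

  The first is a colouring along a well-order (lemma
  \<open>hereditarily_irresolvable_avoid_predecessors\<close>): give each point the colour opposite to one
  already accumulating at it. It shows that, for any well-order whatsoever, the points of some open
  set are not in the closure of their predecessors; so initial segments become closed.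

  The second is a pigeonhole argument. If very many almost disjoint uncountable sets have
  condensation points in a set with few points, then some points are condensation points of many of
  these sets, and two of the sets can be reserved for each such point. This is used with more than
  aleph-one sets and at most aleph-one points
  (\<open>almost_disjoint_large_traces_contradiction\<close>), and with uncountably many sets and countably
  many points (\<open>concentrated_pair_split\<close>).

  Together they show that every uncountable Lindeloef subspace of \<open>U\<close> contains a concentrated
  pair \<open>(T, Q)\<close>: an uncountable set \<open>T\<close> all of whose uncountable subsets have condensation points
  in the countable set \<open>Q\<close> (\<open>condensing_imp_concentrated\<close>). The colouring first yields a relatively
  closed subset of size aleph-one; inside it the pigeonhole argument covers an open piece by
  countably many locally countable sets, and the colouring along this countable cover finds the
  pair.

  It remains to distinguish two cases. If every non-empty open subset of \<open>U\<close> contains a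
  concentrated pair, then these pairs, split in two and made disjoint, resolve a subspace
  (\<open>concentrated_pairs_dense_contradiction\<close>). Otherwise some non-empty open subset of \<open>U\<close> has only
  countable Lindeloef subspaces. There an \<open>L\<close>-space is countably tight, and because
  non-empty open sets are uncountable, a resolvable subspace is built from countable sets
  (\<open>countable_Lindelof_subspaces_contradiction\<close>).
\<close>

section \<open>Sets of size at most aleph-one\<close>

definition le_aleph1 :: "'a set \<Rightarrow> bool"
  where "le_aleph1 A \<longleftrightarrow> |A| \<le>o cardSuc natLeq"

lemma Card_order_aleph1: "Card_order (cardSuc natLeq)"
  by (simp add: cardSuc_Card_order natLeq_Card_order)

lemma infinite_Field_aleph1: "infinite (Field (cardSuc natLeq))"
  using cardSuc_finite natLeq_Card_order Field_natLeq infinite_UNIV_nat by metis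

lemma countable_iff_ordLeq_natLeq: "countable A \<longleftrightarrow> |A| \<le>o natLeq"
proof -
  have "countable A \<longleftrightarrow> |A| \<le>o |UNIV :: nat set|"
    unfolding countable_def card_of_ordLeq[symmetric] by auto
  then show ?thesis
    using card_of_nat ordLeq_ordIso_trans ordIso_symmetric by blast
qed

lemma countable_iff_ordLess_aleph1: "countable A \<longleftrightarrow> |A| <o cardSuc natLeq"
  using countable_iff_ordLeq_natLeq cardSuc_ordLeq_ordLess[OF natLeq_Card_order card_of_Card_order]
  by blast

lemma le_aleph1_countable: "countable A \<Longrightarrow> le_aleph1 A"
  by (simp add: le_aleph1_def countable_iff_ordLess_aleph1 ordLess_imp_ordLeq)

lemma le_aleph1_subset: "A \<subseteq> B \<Longrightarrow> le_aleph1 B \<Longrightarrow> le_aleph1 A"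
  unfolding le_aleph1_def using card_of_mono1 ordLeq_transitive by blast

lemma le_aleph1_image: "le_aleph1 A \<Longrightarrow> le_aleph1 (f ` A)"
  unfolding le_aleph1_def using card_of_image ordLeq_transitive by blast

lemma le_aleph1_UN: "le_aleph1 I \<Longrightarrow> (\<And>i. i \<in> I \<Longrightarrow> le_aleph1 (F i)) \<Longrightarrow> le_aleph1 (\<Union>i\<in>I. F i)"
  unfolding le_aleph1_def
  by (rule card_of_UNION_ordLeq_infinite_Field[OF infinite_Field_aleph1])
     (auto simp: Card_order_aleph1)

lemma le_aleph1_Un: "le_aleph1 A \<Longrightarrow> le_aleph1 B \<Longrightarrow> le_aleph1 (A \<union> B)"
  unfolding le_aleph1_def
  by (rule card_of_Un_ordLeq_infinite_Field[OF infinite_Field_aleph1])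
     (auto simp: Card_order_aleph1)

lemma le_aleph1_Times: "le_aleph1 A \<Longrightarrow> le_aleph1 B \<Longrightarrow> le_aleph1 (A \<times> B)"
  unfolding le_aleph1_def
  by (rule card_of_Times_ordLeq_infinite_Field[OF infinite_Field_aleph1])
     (auto simp: Card_order_aleph1)

lemma uncountable_obtain_le_aleph1_subset:
  assumes "uncountable A"
  obtains B where "B \<subseteq> A" "uncountable B" "le_aleph1 B"
proof -
  have "\<not> |A| <o cardSuc natLeq" using assms by (simp add: countable_iff_ordLess_aleph1)
  then have "cardSuc natLeq \<le>o |A|"
    by (metis not_ordLess_iff_ordLeq card_of_Well_order cardSuc_Well_order natLeq_Card_order)
  with card_of_Field_ordIso[OF Card_order_aleph1] have "|Field (cardSuc natLeq)| \<le>o |A|"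
    by (rule ordIso_ordLeq_trans)
  from iffD1[OF internalize_card_of_ordLeq2 this]
  obtain B where B: "B \<subseteq> A" "( |Field (cardSuc natLeq)|, |B| ) \<in> ordIso" by blast
  have *: "( |B|, cardSuc natLeq) \<in> ordIso"
    by (rule ordIso_transitive[OF ordIso_symmetric[OF B(2)] card_of_Field_ordIso[OF Card_order_aleph1]])
  have "le_aleph1 B"
    unfolding le_aleph1_def by (rule ordIso_imp_ordLeq[OF *])
  moreover have "uncountable B"
    unfolding countable_iff_ordLess_aleph1 by (metis * not_ordLess_ordIso)
  ultimately show ?thesis using that B(1) by blast
qed

lemma le_aleph1_obtain_wf:
  assumes "le_aleph1 A"
  obtains r where "wf r" "total_on A r" "\<forall>x. countable {y. (y, x) \<in> r}"
proof -
  let ?w = "cardSuc natLeq"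
  have "|A| \<le>o |Field ?w|"
    using assms card_of_Field_ordIso[OF Card_order_aleph1] ordIso_symmetric ordLeq_ordIso_trans
    unfolding le_aleph1_def by blast
  then obtain f where f: "inj_on f A" "f ` A \<subseteq> Field ?w"
    unfolding card_of_ordLeq[symmetric] by blast
  have wo: "Well_order ?w" using Card_order_aleph1 card_order_on_well_order_on by blast
  let ?r = "{(x, y). x \<in> A \<and> y \<in> A \<and> (f x, f y) \<in> ?w - Id}"
  have wfw: "wf (?w - Id)" using wo well_order_on_def by blast
  have "wf ?r"
    by (rule wf_subset[OF wf_inv_image[OF wfw, of f]]) (auto simp: inv_image_def)
  moreover have "total_on A ?r"
  proof (rule total_onI)
    fix x y assume that: "x \<in> A" "y \<in> A" "x \<noteq> y"
    have "f x \<noteq> f y" using that f(1) inj_onD by metis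
    moreover have "f x \<in> Field ?w" "f y \<in> Field ?w" using f(2) that by auto
    moreover have "total_on (Field ?w) ?w"
      using wo unfolding well_order_on_def linear_order_on_def by blast
    ultimately have "(f x, f y) \<in> ?w \<or> (f y, f x) \<in> ?w" unfolding total_on_def by blast
    with \<open>f x \<noteq> f y\<close> that show "(x, y) \<in> ?r \<or> (y, x) \<in> ?r" by auto
  qed
  moreover have "countable {y. (y, x) \<in> ?r}" for x
  proof (cases "x \<in> A")
    case True
    have "|underS ?w (f x)| <o ?w"
      by (rule card_of_underS[OF Card_order_aleph1]) (use True f in auto)
    then have "countable (underS ?w (f x))" by (simp add: countable_iff_ordLess_aleph1)
    moreover have "f ` {y. (y, x) \<in> ?r} \<subseteq> underS ?w (f x)" by (auto simp: underS_def)
    moreover have "inj_on f {y. (y, x) \<in> ?r}" by (rule inj_on_subset[OF f(1)]) auto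
    ultimately show ?thesis by (meson countable_image_inj_on countable_subset)
  qed auto
  ultimately show ?thesis by (intro that[of ?r]) auto
qed

text \<open>
  An uncountable subset \<open>B\<close> of size aleph-one cannot lie below a single point, since every
  initial segment is countable; so the initial segments below the points of \<open>B\<close> exhaust \<open>A\<close>.
\<close>

lemma le_aleph1_if_countable_predecessors:
  assumes tot: "total_on A r"
    and count: "\<And>x. x \<in> A \<Longrightarrow> countable {y \<in> A. (y, x) \<in> r}"
  shows "le_aleph1 A"
proof (cases "countable A")
  case False
  then obtain B where B: "B \<subseteq> A" "uncountable B" "le_aleph1 B"
    by (rule uncountable_obtain_le_aleph1_subset)
  have "A \<subseteq> (\<Union>b\<in>B. {y \<in> A. (y, b) \<in> r})"
  proof
    fix y assume y: "y \<in> A"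
    have "countable (insert y {z \<in> A. (z, y) \<in> r})" using count[OF y] by simp
    then have "\<not> B \<subseteq> insert y {z \<in> A. (z, y) \<in> r}"
      using B(2) countable_subset by blast
    then obtain b where "b \<in> B" "b \<noteq> y" "(b, y) \<notin> r" using B(1) by blast
    then show "y \<in> (\<Union>b\<in>B. {y \<in> A. (y, b) \<in> r})" using tot B(1) y unfolding total_on_def by blast
  qed
  moreover have "le_aleph1 (\<Union>b\<in>B. {y \<in> A. (y, b) \<in> r})"
  proof (rule le_aleph1_UN[OF B(3)])
    fix b assume "b \<in> B"
    then have "b \<in> A" using B(1) by (rule rev_subsetD)
    from count[OF this] show "le_aleph1 {y \<in> A. (y, b) \<in> r}" by (rule le_aleph1_countable)
  qed
  ultimately show ?thesis by (rule le_aleph1_subset)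
qed (rule le_aleph1_countable)

text \<open>
  Greedy choice along a well-order: the values already used number at most \<open>|I|\<close>, too few to
  exhaust the next set \<open>F i\<close>.
\<close>

lemma injective_choice:
  assumes "\<And>i. i \<in> I \<Longrightarrow> \<not> |F i| \<le>o |I|"
  obtains h where "inj_on h I" "\<forall>i\<in>I. h i \<in> F i"
proof -
  obtain r where r: "well_order_on UNIV (r :: 'a rel)" using well_order_on by blast
  let ?s = "r - Id"
  have wf: "wf ?s" using r well_order_on_def by blast
  have "\<exists>h. \<forall>i. i \<in> I \<longrightarrow> h i \<in> F i - h ` {j \<in> I. (j, i) \<in> ?s}"
  proof (rule dependent_wf_choice[OF wf])
    fix h h' :: "'a \<Rightarrow> 'b" and i v
    assume "\<And>j. (j, i) \<in> ?s \<Longrightarrow> h j = h' j"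
    then have "h ` {j \<in> I. (j, i) \<in> ?s} = h' ` {j \<in> I. (j, i) \<in> ?s}" by (intro image_cong) auto
    then show "(i \<in> I \<longrightarrow> v \<in> F i - h ` {j \<in> I. (j, i) \<in> ?s}) =
      (i \<in> I \<longrightarrow> v \<in> F i - h' ` {j \<in> I. (j, i) \<in> ?s})" by simp
  next
    fix i and h :: "'a \<Rightarrow> 'b"
    have "|h ` {j \<in> I. (j, i) \<in> ?s}| \<le>o |I|"
      using card_of_image card_of_mono1[of "{j \<in> I. (j, i) \<in> ?s}" I] ordLeq_transitive by blast
    then have "\<not> F i \<subseteq> h ` {j \<in> I. (j, i) \<in> ?s}" if "i \<in> I"
      using assms[OF that] card_of_mono1 ordLeq_transitive by blast
    then show "\<exists>v. i \<in> I \<longrightarrow> v \<in> F i - h ` {j \<in> I. (j, i) \<in> ?s}" by blast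
  qed
  then obtain h where h: "\<And>i. i \<in> I \<Longrightarrow> h i \<in> F i - h ` {j \<in> I. (j, i) \<in> ?s}" by blast
  have "inj_on h I"
  proof (rule inj_onI, rule ccontr)
    fix i j assume ij: "i \<in> I" "j \<in> I" "h i = h j" "i \<noteq> j"
    have "(i, j) \<in> r \<or> (j, i) \<in> r"
      using r ij(4) unfolding well_order_on_def linear_order_on_def total_on_def by blast
    then have "(i, j) \<in> ?s \<or> (j, i) \<in> ?s" using ij(4) by auto
    then show False
    proof
      assume "(i, j) \<in> ?s"
      then have "h i \<in> h ` {k \<in> I. (k, j) \<in> ?s}" using ij(1) by blast
      with h[OF ij(2)] ij(3) show False by simp
    next
      assume "(j, i) \<in> ?s"
      then have "h j \<in> h ` {k \<in> I. (k, i) \<in> ?s}" using ij(2) by blast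
      with h[OF ij(1)] ij(3) show False by simp
    qed
  qed
  then show ?thesis using h by (intro that[of h]) auto
qed

section \<open>Almost disjoint families\<close>

definition almost_disjoint :: "'a set set \<Rightarrow> bool"
  where "almost_disjoint \<D> \<longleftrightarrow> (\<forall>D\<in>\<D>. \<forall>E\<in>\<D>. D \<noteq> E \<longrightarrow> countable (D \<inter> E))"

text \<open>
  Along an order with countable initial segments, each set loses only countably many points when
  its intersections with the earlier ones are removed.
\<close>

lemma disjointify:
  assumes J: "le_aleph1 J"
    and ad: "\<And>i j. i \<in> J \<Longrightarrow> j \<in> J \<Longrightarrow> i \<noteq> j \<Longrightarrow> countable (S i \<inter> S j)"
  obtains S' where "\<forall>j\<in>J. S' j \<subseteq> S j" "\<forall>j\<in>J. countable (S j - S' j)" "disjoint_family_on S' J"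
proof -
  obtain r where r: "wf r" "total_on J r" "\<forall>x. countable {y. (y, x) \<in> r}"
    using le_aleph1_obtain_wf[OF J] .
  define S' where "S' j = S j - (\<Union>i\<in>{i \<in> J. (i, j) \<in> r}. S i)" for j
  show ?thesis
  proof
    show "\<forall>j\<in>J. S' j \<subseteq> S j" unfolding S'_def by blast
    show "\<forall>j\<in>J. countable (S j - S' j)"
    proof
      fix j assume j: "j \<in> J"
      have "S j - S' j = (\<Union>i\<in>{i \<in> J. (i, j) \<in> r}. S j \<inter> S i)" unfolding S'_def by blast
      moreover have "countable {i \<in> J. (i, j) \<in> r}"
        by (rule countable_subset[OF _ r(3)[rule_format, of j]]) auto
      moreover have "countable (S j \<inter> S i)" if "i \<in> {i \<in> J. (i, j) \<in> r}" for i
        using ad[of j i] j that r(1) wf_not_refl by fastforce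
      ultimately show "countable (S j - S' j)" by (metis (no_types, lifting) countable_UN)
    qed
    show "disjoint_family_on S' J"
      unfolding disjoint_family_on_def
    proof (intro ballI impI)
      fix i j assume "i \<in> J" "j \<in> J" "i \<noteq> j"
      moreover then have "(i, j) \<in> r \<or> (j, i) \<in> r" using r(2) by (simp add: total_on_def)
      ultimately show "S' i \<inter> S' j = {}" unfolding S'_def by auto
    qed
  qed
qed

text \<open>
  The diagonal argument by which an uncountable almost disjoint family of at most aleph-one sets
  is never maximal: pick from each member a new point of \<open>G\<close> lying in no earlier member.
\<close>

lemma almost_disjoint_diagonal:
  assumes H: "le_aleph1 \<H>" "uncountable \<H>" "almost_disjoint \<H>"
    and G: "\<And>D. D \<in> \<H> \<Longrightarrow> uncountable (D \<inter> G)"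
  obtains T where "T \<subseteq> G" "uncountable T" "\<forall>D\<in>\<H>. countable (T \<inter> D)"
proof -
  obtain r where r: "wf r" "total_on \<H> r" "\<forall>x. countable {y. (y, x) \<in> r}"
    using le_aleph1_obtain_wf[OF H(1)] .
  let ?p = "\<lambda>D. {E \<in> \<H>. (E, D) \<in> r}"
  have cp: "countable (?p D)" for D by (rule countable_subset[OF _ r(3)[rule_format, of D]]) auto
  have "\<exists>t. \<forall>D. D \<in> \<H> \<longrightarrow> t D \<in> D \<inter> G - \<Union>(?p D) - t ` ?p D"
  proof (rule dependent_wf_choice[OF r(1)])
    fix t t' :: "'a set \<Rightarrow> 'a" and D v
    assume "\<And>E. (E, D) \<in> r \<Longrightarrow> t E = t' E"
    then have "t ` ?p D = t' ` ?p D" by (intro image_cong) auto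
    then show "(D \<in> \<H> \<longrightarrow> v \<in> D \<inter> G - \<Union>(?p D) - t ` ?p D) =
      (D \<in> \<H> \<longrightarrow> v \<in> D \<inter> G - \<Union>(?p D) - t' ` ?p D)" by simp
  next
    fix D and t :: "'a set \<Rightarrow> 'a"
    show "\<exists>v. D \<in> \<H> \<longrightarrow> v \<in> D \<inter> G - \<Union>(?p D) - t ` ?p D"
    proof (cases "D \<in> \<H>")
      case True
      have "countable (D \<inter> E)" if E: "E \<in> ?p D" for E
      proof -
        have "E \<noteq> D" using E wf_not_refl[OF r(1), of D] by auto
        then show ?thesis using H(3) True E unfolding almost_disjoint_def by blast
      qed
      then have "countable (\<Union>E\<in>?p D. D \<inter> E)" using cp by (intro countable_UN) auto
      then have "countable ((\<Union>E\<in>?p D. D \<inter> E) \<union> t ` ?p D)" using cp by simp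
      then have "\<not> D \<inter> G \<subseteq> (\<Union>E\<in>?p D. D \<inter> E) \<union> t ` ?p D"
        using G[OF True] countable_subset by blast
      then show ?thesis by blast
    qed auto
  qed
  then obtain t where t0: "\<forall>D. D \<in> \<H> \<longrightarrow> t D \<in> D \<inter> G - \<Union>(?p D) - t ` ?p D" ..
  have t: "t D \<in> D" "t D \<in> G" "t D \<notin> \<Union>(?p D)" "t D \<notin> t ` ?p D" if "D \<in> \<H>" for D
    using t0[rule_format, OF that] by simp_all
  have inj: "inj_on t \<H>"
  proof (rule inj_onI, rule ccontr)
    fix D E assume *: "D \<in> \<H>" "E \<in> \<H>" "t D = t E" "D \<noteq> E"
    then have "(D, E) \<in> r \<or> (E, D) \<in> r" using r(2) by (simp add: total_on_def)
    then have "t D \<in> t ` ?p E \<or> t E \<in> t ` ?p D" using *(1,2) by auto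
    then show False using t(4)[OF *(1)] t(4)[OF *(2)] *(3) by auto
  qed
  show ?thesis
  proof
    show "t ` \<H> \<subseteq> G" using t(2) by (rule image_subsetI)
    show "uncountable (t ` \<H>)" using H(2) inj countable_image_inj_on by metis
    show "\<forall>D\<in>\<H>. countable (t ` \<H> \<inter> D)"
    proof (rule ballI, rule countable_subset)
      fix D assume D: "D \<in> \<H>"
      show "t ` \<H> \<inter> D \<subseteq> t ` insert D (?p D)"
      proof
        fix x assume "x \<in> t ` \<H> \<inter> D"
        then obtain E where E: "E \<in> \<H>" "x = t E" "x \<in> D" by blast
        then have "D \<notin> ?p E" using t(3)[OF E(1)] by blast
        then have "E = D \<or> (E, D) \<in> r" using r(2) E(1) D by (auto simp: total_on_def)
        then show "x \<in> t ` insert D (?p D)" using E by blast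
      qed
      show "countable (t ` insert D (?p D))" if "D \<in> \<H>" for D using cp[of D] by simp
    qed
  qed
qed

text \<open>
  A set of the class \<open>\<C>\<close> that meets every member of a maximal family in a countable set
  could be added to it.
\<close>

lemma maximal_almost_disjoint:
  assumes D0: "\<D>\<^sub>0 \<subseteq> \<C>" "almost_disjoint \<D>\<^sub>0" and unc: "\<And>C. C \<in> \<C> \<Longrightarrow> uncountable C"
  obtains \<D> where "\<D>\<^sub>0 \<subseteq> \<D>" "\<D> \<subseteq> \<C>" "almost_disjoint \<D>"
    "\<forall>C\<in>\<C>. \<exists>D\<in>\<D>. uncountable (C \<inter> D)"
proof -
  let ?A = "{\<D>. \<D>\<^sub>0 \<subseteq> \<D> \<and> \<D> \<subseteq> \<C> \<and> almost_disjoint \<D>}"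
  have "\<exists>M\<in>?A. \<forall>X\<in>?A. M \<subseteq> X \<longrightarrow> X = M"
  proof (rule subset_Zorn_nonempty)
    show "?A \<noteq> {}" using D0 by blast
    fix c assume c: "c \<noteq> {}" "subset.chain ?A c"
    have sub: "c \<subseteq> ?A" and lin: "\<forall>P\<in>c. \<forall>Q\<in>c. P \<subseteq> Q \<or> Q \<subseteq> P"
      using c(2) by (auto simp: subset_chain_def)
    have "countable (D \<inter> E)" if DE: "D \<in> \<Union>c" "E \<in> \<Union>c" "D \<noteq> E" for D E
    proof -
      obtain P Q where PQ: "P \<in> c" "D \<in> P" "Q \<in> c" "E \<in> Q" using DE(1,2) by auto
      have "\<exists>M\<in>c. D \<in> M \<and> E \<in> M"
        using lin[rule_format, OF PQ(1,3)] PQ by (meson subsetD)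
      then obtain M where M: "M \<in> c" "D \<in> M" "E \<in> M" by auto
      then have "almost_disjoint M" using sub by auto
      then show ?thesis using M(2,3) DE(3) by (simp add: almost_disjoint_def)
    qed
    then have "almost_disjoint (\<Union>c)" by (simp add: almost_disjoint_def)
    moreover have "\<Union>c \<subseteq> \<C>" using sub by auto
    moreover obtain P where "P \<in> c" using c(1) by auto
    then have "\<D>\<^sub>0 \<subseteq> \<Union>c" using sub by auto
    ultimately show "\<Union>c \<in> ?A" by simp
  qed
  then obtain \<D> where "\<D> \<in> ?A" and max: "\<forall>X\<in>?A. \<D> \<subseteq> X \<longrightarrow> X = \<D>" ..
  then have D: "\<D>\<^sub>0 \<subseteq> \<D>" "\<D> \<subseteq> \<C>" "almost_disjoint \<D>" by simp_all
  have "\<forall>C\<in>\<C>. \<exists>D\<in>\<D>. uncountable (C \<inter> D)"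
  proof (rule ballI, rule ccontr)
    fix C assume C: "C \<in> \<C>" and *: "\<not> (\<exists>D\<in>\<D>. uncountable (C \<inter> D))"
    then have "almost_disjoint (insert C \<D>)"
      using D(3) by (simp add: almost_disjoint_def Int_commute)
    then have "insert C \<D> = \<D>" using D C max by (simp add: subset_insertI subset_insertI2)
    then have "C \<in> \<D>" by auto
    with * unc[OF C] show False by auto
  qed
  with D show ?thesis by (rule that)
qed

lemma uncountable_partition:
  assumes "uncountable T"
  obtains P where "\<forall>t\<in>T. P t \<subseteq> T \<and> uncountable (P t)" "disjoint_family_on P T"
proof -
  have "infinite T" using assms countable_finite by blast
  then obtain f where f: "bij_betw f (T \<times> T) T"
    using card_of_Times_same_infinite card_of_ordIso by blast
  define P where "P t = f ` ({t} \<times> T)" for t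
  have inj: "inj_on f (T \<times> T)" using f bij_betw_def by blast
  show ?thesis
  proof
    show "\<forall>t\<in>T. P t \<subseteq> T \<and> uncountable (P t)"
    proof (intro ballI conjI)
      fix t assume t: "t \<in> T"
      show "P t \<subseteq> T" using t f unfolding P_def bij_betw_def by blast
      show "uncountable (P t)"
      proof
        assume "countable (P t)"
        moreover have "inj_on f ({t} \<times> T)" by (rule inj_on_subset[OF inj]) (use t in auto)
        ultimately have "countable ({t} \<times> T)" unfolding P_def using countable_image_inj_on by blast
        then have "countable (snd ` ({t} \<times> T))" by (rule countable_image)
        then show False using assms by simp
      qed
    qed
    show "disjoint_family_on P T"
      using inj unfolding P_def inj_on_def disjoint_family_on_def by blast
  qed
qed

section \<open>Hereditarily irresolvable sets\<close>

lemma regular_space_shrink: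
  assumes "regular_space X" "openin X W" "x \<in> W"
  obtains V C where "openin X V" "closedin X C" "x \<in> V" "V \<subseteq> C" "C \<subseteq> W"
proof -
  have "\<exists>V C. openin X V \<and> closedin X C \<and> x \<in> V \<and> V \<subseteq> C \<and> C \<subseteq> W"
    using assms(1)[folded neighbourhood_base_of_closedin] assms(2,3) by (simp add: neighbourhood_base_of)
  then show ?thesis using that by auto
qed

text \<open>
  No non-empty subset of \<open>U\<close> is resolvable as a subspace; a resolvable subset is given by
  two disjoint sets, each contained in the closure of the other.
\<close>

definition hereditarily_irresolvable :: "'a topology \<Rightarrow> 'a set \<Rightarrow> bool" where
  "hereditarily_irresolvable X U \<longleftrightarrow>
     (\<forall>D E. D \<subseteq> U \<and> E \<subseteq> U \<and> D \<inter> E = {} \<and> D \<subseteq> X closure_of E \<and> E \<subseteq> X closure_of D \<longrightarrow> D = {})"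

lemma hereditarily_irresolvableD:
  assumes "hereditarily_irresolvable X U" "D \<subseteq> U" "E \<subseteq> U" "D \<inter> E = {}"
    "D \<subseteq> X closure_of E" "E \<subseteq> X closure_of D"
  shows "D = {}"
  using assms unfolding hereditarily_irresolvable_def by blast

text \<open>
  A maximal pair of disjoint sets that lie in each other's closure must be dense: otherwise a
  resolvable piece of the complement of its closure could be added. For Zorn's lemma a pair of sets
  is coded as one set of points tagged by a Boolean.
\<close>

lemma resolvable_if_not_hereditarily_irresolvable:
  assumes "\<And>U. openin X U \<Longrightarrow> U \<noteq> {} \<Longrightarrow> \<not> hereditarily_irresolvable X U"
  shows "resolvable X"
proof -
  define red where "red A = {x \<in> topspace X. (x, True) \<in> A}" for A
  define blue where "blue A = {x \<in> topspace X. (x, False) \<in> A}" for A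
  have sub: "red A \<subseteq> topspace X" "blue A \<subseteq> topspace X" for A
    by (auto simp: red_def blue_def)
  define ok where "ok A \<longleftrightarrow> A \<subseteq> topspace X \<times> UNIV \<and> red A \<inter> blue A = {} \<and> red A \<subseteq> X closure_of blue A \<and> blue A \<subseteq> X closure_of red A" for A
  have "\<exists>M\<in>Collect ok. \<forall>A\<in>Collect ok. M \<subseteq> A \<longrightarrow> A = M"
  proof (rule subset_Zorn')
    fix c assume "subset.chain (Collect ok) c"
    then have c: "\<And>A. A \<in> c \<Longrightarrow> ok A" and lin: "\<forall>P\<in>c. \<forall>Q\<in>c. P \<subseteq> Q \<or> Q \<subseteq> P"
      by (auto simp: subset_chain_def)
    have cl: "X closure_of red A \<subseteq> X closure_of red (\<Union>c)" "X closure_of blue A \<subseteq> X closure_of blue (\<Union>c)"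
      if "A \<in> c" for A
      using that by (auto simp: red_def blue_def intro!: closure_of_mono)
    have "red (\<Union>c) \<inter> blue (\<Union>c) = {}"
    proof (rule ccontr)
      assume "red (\<Union>c) \<inter> blue (\<Union>c) \<noteq> {}"
      then obtain x P Q where x: "x \<in> topspace X" "P \<in> c" "(x, True) \<in> P" "Q \<in> c" "(x, False) \<in> Q"
        by (auto simp: red_def blue_def)
      have "\<exists>M\<in>c. (x, True) \<in> M \<and> (x, False) \<in> M"
        using lin[rule_format, OF x(2,4)] x by (meson subsetD)
      then obtain M where "M \<in> c" "(x, True) \<in> M" "(x, False) \<in> M" by auto
      then show False using c[of M] x(1) by (auto simp: ok_def red_def blue_def)
    qed
    moreover have "red (\<Union>c) \<subseteq> X closure_of blue (\<Union>c)"
    proof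
      fix x assume "x \<in> red (\<Union>c)"
      then obtain A where A: "A \<in> c" "x \<in> red A" by (auto simp: red_def)
      then show "x \<in> X closure_of blue (\<Union>c)" using c[OF A(1)] cl(2)[OF A(1)] by (auto simp: ok_def)
    qed
    moreover have "blue (\<Union>c) \<subseteq> X closure_of red (\<Union>c)"
    proof
      fix x assume "x \<in> blue (\<Union>c)"
      then obtain A where A: "A \<in> c" "x \<in> blue A" by (auto simp: blue_def)
      then show "x \<in> X closure_of red (\<Union>c)" using c[OF A(1)] cl(1)[OF A(1)] by (auto simp: ok_def)
    qed
    moreover have "\<Union>c \<subseteq> topspace X \<times> UNIV"
      by (rule Union_least) (use c in \<open>simp add: ok_def\<close>)
    ultimately show "\<Union>c \<in> Collect ok" by (simp add: ok_def)
  qed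
  then obtain M where M: "ok M" and max: "\<And>A. ok A \<Longrightarrow> M \<subseteq> A \<Longrightarrow> A = M" by auto
  let ?D = "red M" and ?E = "blue M"
  have cl_eq: "X closure_of ?E = X closure_of ?D"
    using M closure_of_minimal[of ?E "X closure_of ?D" X] closure_of_minimal[of ?D "X closure_of ?E" X]
    by (auto simp: ok_def)
  have "X closure_of ?D = topspace X"
  proof (rule ccontr)
    assume ne: "X closure_of ?D \<noteq> topspace X"
    define U where "U = topspace X - X closure_of ?D"
    have "openin X U" unfolding U_def by (simp add: openin_diff)
    moreover have "U \<noteq> {}" using ne closure_of_subset_topspace[of X ?D] unfolding U_def by auto
    ultimately have "\<not> hereditarily_irresolvable X U" by (rule assms)
    then obtain D E where DE: "D \<subseteq> U" "E \<subseteq> U" "D \<inter> E = {}" "D \<subseteq> X closure_of E" "E \<subseteq> X closure_of D" "D \<noteq> {}"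
      unfolding hereditarily_irresolvable_def by auto
    have out: "x \<notin> ?D" "x \<notin> ?E" if "x \<in> U" for x
    proof -
      show "x \<notin> ?D" using that closure_of_subset[OF sub(1)[of M]] by (auto simp: U_def)
      show "x \<notin> ?E" using that closure_of_subset[OF sub(2)[of M]] cl_eq by (auto simp: U_def)
    qed
    let ?A = "M \<union> D \<times> {True} \<union> E \<times> {False}"
    have UX: "U \<subseteq> topspace X" unfolding U_def by auto
    have r: "red ?A = ?D \<union> D" and b: "blue ?A = ?E \<union> E"
      using DE(1,2) UX by (auto simp: red_def blue_def)
    have "ok ?A"
      unfolding ok_def r b using M DE UX out by (auto simp: ok_def closure_of_Un)
    then have "?A = M" by (rule max) auto
    moreover obtain x where "x \<in> D" using DE(6) by auto
    ultimately have "x \<in> ?D" using DE(1) UX by (auto simp: red_def)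
    then show False using out(1)[of x] \<open>x \<in> D\<close> DE(1) by auto
  qed
  then have "dense_in X ?D" "dense_in X (topspace X - ?D)"
  proof -
    assume D: "X closure_of ?D = topspace X"
    then show "dense_in X ?D" by (simp add: dense_in_def sub)
    have "?E \<subseteq> topspace X - ?D" using M sub(2)[of M] by (auto simp: ok_def)
    then have "X closure_of ?E \<subseteq> X closure_of (topspace X - ?D)" by (rule closure_of_mono)
    then show "dense_in X (topspace X - ?D)"
      using D cl_eq closure_of_subset_topspace[of X "topspace X - ?D"] by (auto simp: dense_in_def)
  qed
  then show ?thesis
    unfolding resolvable_def using sub(1)[of M] by (intro exI[of _ ?D] exI[of _ "topspace X - ?D"]) auto
qed

text \<open>
  Colour the points of \<open>K\<close> by well-founded recursion: a point gets the colour opposite to one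
  whose earlier points accumulate at it. Every point in the closure of its predecessors then lies
  in the closure of both colours, so such points cannot be dense in an irresolvable set. The
  relation is arbitrary, so it can be chosen to suit the argument.
\<close>

lemma hereditarily_irresolvable_avoid_predecessors:
  assumes HI: "hereditarily_irresolvable X U" and U: "U \<subseteq> topspace X"
    and K: "K \<subseteq> U" "K \<noteq> {}" and wf: "wf r"
  obtains W where "openin X W" "W \<inter> K \<noteq> {}"
    "\<forall>x\<in>W \<inter> K. x \<notin> X closure_of {y \<in> K. (y, x) \<in> r}"
proof -
  have "\<exists>c. \<forall>x. c x = (x \<notin> X closure_of {y \<in> K. (y, x) \<in> r \<and> c y})"
  proof (rule dependent_wf_choice[OF wf])
    fix c d :: "'a \<Rightarrow> bool" and x b
    assume "\<And>y. (y, x) \<in> r \<Longrightarrow> c y = d y"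
    then have "{y \<in> K. (y, x) \<in> r \<and> c y} = {y \<in> K. (y, x) \<in> r \<and> d y}" by auto
    then show "(b = (x \<notin> X closure_of {y \<in> K. (y, x) \<in> r \<and> c y})) =
      (b = (x \<notin> X closure_of {y \<in> K. (y, x) \<in> r \<and> d y}))" by simp
  qed auto
  then obtain c where c: "\<forall>x. c x = (x \<notin> X closure_of {y \<in> K. (y, x) \<in> r \<and> c y})" ..
  define A where "A = {x \<in> K. x \<in> X closure_of {y \<in> K. (y, x) \<in> r}}"
  let ?D = "{x \<in> K. c x}" and ?E = "{x \<in> K. \<not> c x}"
  have KX: "K \<subseteq> topspace X" using K(1) U by auto
  have in_own: "x \<in> X closure_of ?D" if "x \<in> ?D" for x
    using that closure_of_subset[of ?D X] KX by auto
  have in_own': "x \<in> X closure_of ?E" if "x \<in> ?E" for x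
    using that closure_of_subset[of ?E X] KX by auto
  have A: "x \<in> X closure_of ?D \<and> x \<in> X closure_of ?E" if x: "x \<in> A" for x
  proof (cases "c x")
    case True
    have "{y \<in> K. (y, x) \<in> r} = {y \<in> K. (y, x) \<in> r \<and> c y} \<union> {y \<in> K. (y, x) \<in> r \<and> \<not> c y}" by auto
    then have "X closure_of {y \<in> K. (y, x) \<in> r} =
      X closure_of {y \<in> K. (y, x) \<in> r \<and> c y} \<union> X closure_of {y \<in> K. (y, x) \<in> r \<and> \<not> c y}"
      using closure_of_Un by metis
    moreover have "x \<notin> X closure_of {y \<in> K. (y, x) \<in> r \<and> c y}" using c[rule_format, of x] True by simp
    ultimately have "x \<in> X closure_of {y \<in> K. (y, x) \<in> r \<and> \<not> c y}"
      using x by (auto simp: A_def)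
    moreover have "X closure_of {y \<in> K. (y, x) \<in> r \<and> \<not> c y} \<subseteq> X closure_of ?E" by (rule closure_of_mono) auto
    ultimately show ?thesis using in_own[of x] True x by (auto simp: A_def)
  next
    case False
    then have "x \<in> X closure_of {y \<in> K. (y, x) \<in> r \<and> c y}" using c[rule_format, of x] by simp
    moreover have "X closure_of {y \<in> K. (y, x) \<in> r \<and> c y} \<subseteq> X closure_of ?D" by (rule closure_of_mono) auto
    ultimately show ?thesis using in_own'[of x] False x by (auto simp: A_def)
  qed
  have "\<not> K \<subseteq> X closure_of A"
  proof
    assume dense: "K \<subseteq> X closure_of A"
    have "A \<subseteq> X closure_of ?D" "A \<subseteq> X closure_of ?E" using A by auto
    then have "X closure_of A \<subseteq> X closure_of ?D" "X closure_of A \<subseteq> X closure_of ?E"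
      by (simp_all add: closure_of_minimal)
    with dense have "?D \<subseteq> X closure_of ?E" "?E \<subseteq> X closure_of ?D" by auto
    moreover have "?D \<subseteq> U" "?E \<subseteq> U" "?D \<inter> ?E = {}" "?E \<inter> ?D = {}" using K(1) by auto
    ultimately have "?D = {}" "?E = {}" by (meson hereditarily_irresolvableD[OF HI])+
    with K(2) show False by auto
  qed
  then obtain x where "x \<in> K" "x \<notin> X closure_of A" by auto
  show ?thesis
  proof (rule that[of "topspace X - X closure_of A"])
    show "openin X (topspace X - X closure_of A)" by (simp add: openin_diff)
    show "(topspace X - X closure_of A) \<inter> K \<noteq> {}"
      using \<open>x \<in> K\<close> \<open>x \<notin> X closure_of A\<close> KX by auto
    have "y \<notin> X closure_of {z \<in> K. (z, y) \<in> r}" if y: "y \<in> (topspace X - X closure_of A) \<inter> K" for y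
    proof -
      have "A \<subseteq> topspace X" using KX unfolding A_def by auto
      then have "y \<notin> A" using y closure_of_subset[of A X] by auto
      then show ?thesis using y unfolding A_def by auto
    qed
    then show "\<forall>y\<in>(topspace X - X closure_of A) \<inter> K. y \<notin> X closure_of {z \<in> K. (z, y) \<in> r}" ..
  qed
qed

section \<open>Condensation points and concentrated pairs\<close>

definition condensation_points :: "'a topology \<Rightarrow> 'a set \<Rightarrow> 'a set" where
  "condensation_points X T = {x \<in> topspace X. \<forall>U. openin X U \<and> x \<in> U \<longrightarrow> uncountable (U \<inter> T)}"

lemma condensation_points_mono: "S \<subseteq> T \<Longrightarrow> condensation_points X S \<subseteq> condensation_points X T"
  unfolding condensation_points_def by (auto dest: countable_subset[OF Int_mono[OF subset_refl]])

lemma condensation_points_closedin: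
  assumes "closedin X C" "T \<subseteq> C"
  shows "condensation_points X T \<subseteq> C"
proof
  fix x assume x: "x \<in> condensation_points X T"
  show "x \<in> C"
  proof (rule ccontr)
    assume "x \<notin> C"
    then have "x \<in> topspace X - C" using x by (auto simp: condensation_points_def)
    moreover have "openin X (topspace X - C)" using assms(1) by (simp add: closedin_def)
    ultimately have "uncountable ((topspace X - C) \<inter> T)" using x by (auto simp: condensation_points_def)
    moreover have "(topspace X - C) \<inter> T = {}" using assms(2) by auto
    ultimately show False by simp
  qed
qed

lemma condensation_points_subset_closure: "condensation_points X T \<subseteq> X closure_of T"
proof
  fix x assume x: "x \<in> condensation_points X T"
  show "x \<in> X closure_of T"
    unfolding in_closure_of
  proof (intro conjI allI impI)
    show "x \<in> topspace X" using x by (simp add: condensation_points_def)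
    fix U assume "x \<in> U \<and> openin X U"
    then have "uncountable (U \<inter> T)" using x by (simp add: condensation_points_def)
    then have "U \<inter> T \<noteq> {}" by auto
    then show "\<exists>y. y \<in> T \<and> y \<in> U" by auto
  qed
qed

text \<open>
  The trace of the Lindeloef property on which the proof runs: a Lindeloef set
  covered by open sets that have countable trace on \<open>T\<close> has itself countable trace on \<open>T\<close>.
\<close>

definition condensing :: "'a topology \<Rightarrow> 'a set \<Rightarrow> bool" where
  "condensing X P \<longleftrightarrow> (\<forall>T\<subseteq>P. uncountable T \<longrightarrow> condensation_points X T \<inter> P \<noteq> {})"

lemma condensingE:
  assumes "condensing X P" "T \<subseteq> P" "uncountable T"
  obtains x where "x \<in> P" "x \<in> condensation_points X T"
proof -
  have "condensation_points X T \<inter> P \<noteq> {}" using assms by (simp add: condensing_def)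
  then show ?thesis using that by auto
qed

lemma Lindelof_imp_condensing:
  assumes P: "P \<subseteq> topspace X" and L: "Lindelof_space (subtopology X P)"
  shows "condensing X P"
  unfolding condensing_def
proof (intro allI impI)
  fix T assume T: "T \<subseteq> P" "uncountable T"
  show "condensation_points X T \<inter> P \<noteq> {}"
  proof
    assume none: "condensation_points X T \<inter> P = {}"
    let ?\<U> = "{U. openin X U \<and> countable (U \<inter> T)}"
    have "P \<subseteq> \<Union>?\<U>" using none P by (auto simp: condensation_points_def)
    then obtain \<V> where V: "countable \<V>" "\<V> \<subseteq> ?\<U>" "P \<subseteq> \<Union>\<V>"
      using L[unfolded Lindelof_space_subtopology_subset[OF P], rule_format, of ?\<U>] by auto
    have "T \<subseteq> (\<Union>U\<in>\<V>. U \<inter> T)" using V(3) T(1) by auto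
    moreover have "countable (\<Union>U\<in>\<V>. U \<inter> T)" by (rule countable_UN[OF V(1)]) (use V(2) in auto)
    ultimately show False using T(2) countable_subset by metis
  qed
qed

lemma condensing_relatively_closed:
  assumes P: "condensing X P" and K: "K \<subseteq> P" "P \<inter> X closure_of K \<subseteq> K"
  shows "condensing X K"
  unfolding condensing_def
proof (intro allI impI)
  fix T assume T: "T \<subseteq> K" "uncountable T"
  then have "T \<subseteq> P" using K(1) by auto
  then obtain x where x: "x \<in> P" "x \<in> condensation_points X T" using condensingE[OF P _ T(2)] by metis
  then have "x \<in> X closure_of K"
    using condensation_points_subset_closure[of X T] closure_of_mono[OF T(1)] by auto
  with x K(2) show "condensation_points X T \<inter> K \<noteq> {}" by auto
qed

lemma condensing_Int_closedin:
  assumes "condensing X P" "closedin X C"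
  shows "condensing X (C \<inter> P)"
proof (rule condensing_relatively_closed[OF assms(1)])
  have "X closure_of (C \<inter> P) \<subseteq> C" using assms(2) by (simp add: closure_of_minimal)
  then show "P \<inter> X closure_of (C \<inter> P) \<subseteq> C \<inter> P" by auto
qed auto

text \<open>
  Every open set containing \<open>Q\<close> contains all but countably many points of \<open>T\<close>. The
  combination of an uncountable \<open>T\<close> and a countable \<open>Q\<close> is what allows a pigeonhole argument.
\<close>

definition concentrated_pair :: "'a topology \<Rightarrow> 'a set \<Rightarrow> 'a set \<Rightarrow> bool" where
  "concentrated_pair X T Q \<longleftrightarrow> uncountable T \<and> countable Q \<and>
     (\<forall>S\<subseteq>T. uncountable S \<longrightarrow> condensation_points X S \<inter> Q \<noteq> {})"

lemma concentrated_pair_subset: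
  assumes "concentrated_pair X T Q" "S \<subseteq> T" "uncountable S"
  shows "concentrated_pair X S Q"
  using assms unfolding concentrated_pair_def by auto

lemma concentrated_pair_Int_closedin:
  assumes "concentrated_pair X T Q" "closedin X C" "uncountable (T \<inter> C)"
  shows "concentrated_pair X (T \<inter> C) (Q \<inter> C)"
  unfolding concentrated_pair_def
proof (intro conjI allI impI)
  show "countable (Q \<inter> C)" using assms(1) by (simp add: concentrated_pair_def)
  fix S assume S: "S \<subseteq> T \<inter> C" "uncountable S"
  then have "condensation_points X S \<inter> Q \<noteq> {}" using assms(1) by (simp add: concentrated_pair_def)
  moreover have "condensation_points X S \<subseteq> C" using condensation_points_closedin[OF assms(2)] S(1) by auto
  ultimately show "condensation_points X S \<inter> (Q \<inter> C) \<noteq> {}" by auto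
qed (rule assms(3))

section \<open>Large condensing sets contain a concentrated pair\<close>

definition uncountably_crowded :: "'a topology \<Rightarrow> 'a set \<Rightarrow> bool" where
  "uncountably_crowded X K \<longleftrightarrow> (\<forall>W. openin X W \<and> W \<inter> K \<noteq> {} \<longrightarrow> uncountable (W \<inter> K))"

text \<open>
  Let \<open>K\<close> be the largest uncountably crowded subset. If it is empty, then the set of condensation
  points of \<open>P\<close> in \<open>P\<close> has a non-empty relatively open countable part, and near a point of that part
  every uncountable set must condense at this countable part.
\<close>

lemma condensing_crowded_or_concentrated:
  assumes reg: "regular_space X" and P: "P \<subseteq> topspace X" "uncountable P" "condensing X P"
  shows "(\<exists>T Q. T \<subseteq> P \<and> Q \<subseteq> P \<and> concentrated_pair X T Q) \<or>
    (\<exists>K\<subseteq>P. K \<noteq> {} \<and> condensing X K \<and> uncountably_crowded X K)"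
proof -
  define K where "K = \<Union>{S. S \<subseteq> P \<and> uncountably_crowded X S}"
  have KP: "K \<subseteq> P" unfolding K_def by auto
  have crowded: "uncountably_crowded X K"
    unfolding uncountably_crowded_def
  proof (intro allI impI)
    fix W assume W: "openin X W \<and> W \<inter> K \<noteq> {}"
    then obtain S where S: "S \<subseteq> P" "uncountably_crowded X S" "W \<inter> S \<noteq> {}" unfolding K_def by auto
    then have "uncountable (W \<inter> S)" using W unfolding uncountably_crowded_def by simp
    moreover have "W \<inter> S \<subseteq> W \<inter> K" using S unfolding K_def by auto
    ultimately show "uncountable (W \<inter> K)" by (meson countable_subset)
  qed
  have "uncountably_crowded X (P \<inter> X closure_of K)"
    unfolding uncountably_crowded_def
  proof (intro allI impI)
    fix W assume W: "openin X W \<and> W \<inter> (P \<inter> X closure_of K) \<noteq> {}"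
    then have "W \<inter> K \<noteq> {}" by (metis Int_left_commute Int_empty_right openin_Int_closure_of_eq_empty)
    then have "uncountable (W \<inter> K)" using W crowded unfolding uncountably_crowded_def by simp
    moreover have "W \<inter> K \<subseteq> W \<inter> (P \<inter> X closure_of K)"
      using KP P(1) closure_of_subset[of K X] by auto
    ultimately show "uncountable (W \<inter> (P \<inter> X closure_of K))" by (meson countable_subset)
  qed
  then have "P \<inter> X closure_of K \<subseteq> K" unfolding K_def by auto
  then have condK: "condensing X K" by (rule condensing_relatively_closed[OF P(3) KP])
  show ?thesis
  proof (cases "K = {}")
    case False
    then show ?thesis using KP condK crowded by auto
  next
    case True
    define R where "R = P \<inter> condensation_points X P"
    have "R \<noteq> {}" unfolding R_def using condensingE[OF P(3) subset_refl P(2)] by auto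
    have "\<not> uncountably_crowded X R"
    proof
      assume "uncountably_crowded X R"
      then have "R \<subseteq> K" unfolding K_def R_def by auto
      with \<open>R \<noteq> {}\<close> True show False by simp
    qed
    then obtain W where W: "openin X W" "W \<inter> R \<noteq> {}" "countable (W \<inter> R)"
      unfolding uncountably_crowded_def by auto
    then obtain p where p: "p \<in> W" "p \<in> R" by auto
    obtain V C where VC: "openin X V" "closedin X C" "p \<in> V" "V \<subseteq> C" "C \<subseteq> W"
      using regular_space_shrink[OF reg W(1) p(1)] .
    have "uncountable (V \<inter> P)" using p(2) VC(1,3) unfolding R_def condensation_points_def by simp
    then have unc: "uncountable (C \<inter> P)" using VC(4) by (meson Int_mono countable_subset subset_refl)
    have "concentrated_pair X (C \<inter> P) (C \<inter> R)"
      unfolding concentrated_pair_def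
    proof (intro conjI allI impI)
      show "countable (C \<inter> R)" using W(3) VC(5) by (meson Int_mono countable_subset subset_refl)
      fix S assume S: "S \<subseteq> C \<inter> P" "uncountable S"
      then have "S \<subseteq> P" by auto
      then obtain x where x: "x \<in> P" "x \<in> condensation_points X S" using condensingE[OF P(3) _ S(2)] by metis
      moreover have "x \<in> C" using x(2) condensation_points_closedin[OF VC(2), of S] S(1) by auto
      moreover have "x \<in> condensation_points X P" using x(2) condensation_points_mono[OF \<open>S \<subseteq> P\<close>] by auto
      ultimately show "condensation_points X S \<inter> (C \<inter> R) \<noteq> {}" unfolding R_def by auto
    qed (rule unc)
    moreover have "C \<inter> R \<subseteq> P" unfolding R_def by auto
    ultimately show ?thesis by (intro disjI1 exI[of _ "C \<inter> P"] exI[of _ "C \<inter> R"]) auto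
  qed
qed

definition large_trace :: "'a set set \<Rightarrow> 'a set \<Rightarrow> 'a set set" where
  "large_trace \<D> S = {D \<in> \<D>. uncountable (D \<inter> S)}"

text \<open>
  Each set \<open>D \<inter> N\<close> has a condensation point in \<open>K\<close>, and more than aleph-one sets \<open>D\<close> share the
  at most aleph-one points of \<open>K\<close>. Hence the points \<open>q\<close> at which more than aleph-one sets of the
  family condense are dense around \<open>N\<close>. There is then room to choose two sets of the family for each
  such \<open>q\<close>, all different; made disjoint, they form two disjoint dense subsets of \<open>N\<close>.
\<close>

lemma almost_disjoint_large_traces_contradiction:
  assumes reg: "regular_space X" and HI: "hereditarily_irresolvable X U"
    and K: "K \<subseteq> U" "condensing X K" "le_aleph1 K"
    and N: "N \<subseteq> K" "N \<noteq> {}" and UX: "U \<subseteq> topspace X"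
    and ad: "almost_disjoint \<D>"
    and large: "\<And>W. openin X W \<Longrightarrow> W \<inter> N \<noteq> {} \<Longrightarrow> \<not> le_aleph1 (large_trace \<D> (W \<inter> N))"
  shows False
proof -
  define F where "F q = {D \<in> \<D>. q \<in> condensation_points X (D \<inter> N)}" for q
  define R where "R = {q \<in> K. \<not> le_aleph1 (F q)}"
  have meet: "W \<inter> R \<noteq> {}" if W: "openin X W" "x \<in> W" "x \<in> N" for W x
  proof
    assume none: "W \<inter> R = {}"
    obtain V C where VC: "openin X V" "closedin X C" "x \<in> V" "V \<subseteq> C" "C \<subseteq> W"
      using regular_space_shrink[OF reg W(1,2)] .
    have "large_trace \<D> (V \<inter> N) \<subseteq> (\<Union>q\<in>K \<inter> W. F q)"
    proof
      fix D assume D: "D \<in> large_trace \<D> (V \<inter> N)"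
      then have unc: "uncountable (D \<inter> (V \<inter> N))" and DD: "D \<in> \<D>" by (auto simp: large_trace_def)
      have "D \<inter> (V \<inter> N) \<subseteq> K" using N(1) by auto
      then obtain q where q: "q \<in> K" "q \<in> condensation_points X (D \<inter> (V \<inter> N))"
        using condensingE[OF K(2) _ unc] by metis
      have "q \<in> C" using q(2) condensation_points_closedin[OF VC(2), of "D \<inter> (V \<inter> N)"] VC(4) by auto
      moreover have "q \<in> condensation_points X (D \<inter> N)"
        using q(2) condensation_points_mono[of "D \<inter> (V \<inter> N)" "D \<inter> N"] by auto
      ultimately show "D \<in> (\<Union>q\<in>K \<inter> W. F q)" using q(1) VC(5) DD unfolding F_def by auto
    qed
    moreover have "le_aleph1 (\<Union>q\<in>K \<inter> W. F q)"
    proof (rule le_aleph1_UN)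
      show "le_aleph1 (K \<inter> W)" by (rule le_aleph1_subset[OF _ K(3)]) auto
      show "le_aleph1 (F q)" if "q \<in> K \<inter> W" for q using that none unfolding R_def by auto
    qed
    ultimately have "le_aleph1 (large_trace \<D> (V \<inter> N))" by (rule le_aleph1_subset)
    with large[OF VC(1)] VC(3) W(3) show False by auto
  qed
  have N_cl: "N \<subseteq> X closure_of R"
  proof
    fix x assume x: "x \<in> N"
    have "x \<in> topspace X" using x N(1) K(1) UX by auto
    moreover have "\<exists>y. y \<in> R \<and> y \<in> W" if "x \<in> W \<and> openin X W" for W
      using meet[of W x] that x by auto
    ultimately show "x \<in> X closure_of R" by (simp add: in_closure_of)
  qed
  let ?J = "R \<times> (UNIV :: bool set)"
  have J: "le_aleph1 ?J"
    by (rule le_aleph1_Times[OF le_aleph1_subset[OF _ K(3)] le_aleph1_countable]) (auto simp: R_def)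
  have "\<not> |F (fst i)| \<le>o |?J|" if "i \<in> ?J" for i
  proof
    assume "|F (fst i)| \<le>o |?J|"
    then have "le_aleph1 (F (fst i))"
      unfolding le_aleph1_def by (rule ordLeq_transitive[OF _ J[unfolded le_aleph1_def]])
    with that show False by (auto simp: R_def)
  qed
  then obtain h where inj: "inj_on h ?J" and h: "\<forall>i\<in>?J. h i \<in> F (fst i)"
    by (rule injective_choice)
  have hD: "h i \<in> \<D>" if "i \<in> ?J" for i using h[rule_format, OF that] by (simp add: F_def)
  have adN: "countable ((h i \<inter> N) \<inter> (h j \<inter> N))" if "i \<in> ?J" "j \<in> ?J" "i \<noteq> j" for i j
  proof -
    have "h i \<noteq> h j" using inj that inj_onD by metis
    then have "countable (h i \<inter> h j)" using ad hD that unfolding almost_disjoint_def by simp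
    then show ?thesis by (rule countable_subset[rotated]) auto
  qed
  obtain S where S: "\<forall>j\<in>?J. S j \<subseteq> h j \<inter> N" "\<forall>j\<in>?J. countable (h j \<inter> N - S j)"
    "disjoint_family_on S ?J"
    using disjointify[OF J adN] .
  define E where "E b = (\<Union>q\<in>R. S (q, b))" for b
  have EN: "E b \<subseteq> N" for b using S(1) unfolding E_def by auto
  have R_cl: "R \<subseteq> X closure_of E b" for b
  proof
    fix q assume q: "q \<in> R"
    then have J: "(q, b) \<in> ?J" by simp
    have qF: "q \<in> condensation_points X (h (q, b) \<inter> N)" using h[rule_format, OF J] by (simp add: F_def)
    show "q \<in> X closure_of E b"
      unfolding in_closure_of
    proof (intro conjI allI impI)
      show "q \<in> topspace X" using q K(1) UX unfolding R_def by auto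
      fix W assume "q \<in> W \<and> openin X W"
      then have "uncountable (W \<inter> (h (q, b) \<inter> N))" using qF by (simp add: condensation_points_def)
      then have "\<not> W \<inter> (h (q, b) \<inter> N) \<subseteq> h (q, b) \<inter> N - S (q, b)"
        using S(2)[rule_format, OF J] countable_subset by metis
      then show "\<exists>y. y \<in> E b \<and> y \<in> W" using q unfolding E_def by auto
    qed
  qed
  have dense: "E b \<subseteq> X closure_of E c" for b c
    using EN[of b] N_cl closure_of_minimal[OF R_cl[of c] closedin_closure_of] by auto
  have "E True \<inter> E False = {}"
  proof (rule ccontr)
    assume "E True \<inter> E False \<noteq> {}"
    then obtain x p q where "p \<in> R" "q \<in> R" "x \<in> S (p, True)" "x \<in> S (q, False)"
      unfolding E_def by auto
    moreover have "S (p, True) \<inter> S (q, False) = {}" by (rule disjoint_family_onD[OF S(3)]) (use \<open>p \<in> R\<close> \<open>q \<in> R\<close> in auto)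
    ultimately show False by auto
  qed
  moreover have "E b \<subseteq> U" for b using EN[of b] N(1) K(1) by (meson subset_trans)
  ultimately have "E True = {}" by (intro hereditarily_irresolvableD[OF HI _ _ _ dense dense])
  then have "R = {}" using R_cl[of True] by simp
  with N_cl N(2) show False by simp
qed

lemma exists_uncountable_almost_disjoint:
  assumes "uncountable T"
  obtains \<D> where "almost_disjoint \<D>" "\<D> \<subseteq> {D. D \<subseteq> T \<and> uncountable D}" "\<not> le_aleph1 \<D>"
proof -
  obtain P where P: "\<forall>t\<in>T. P t \<subseteq> T \<and> uncountable (P t)" "disjoint_family_on P T"
    using uncountable_partition[OF assms] .
  let ?C = "{D. D \<subseteq> T \<and> uncountable D}"
  have inj: "inj_on P T"
  proof (rule inj_onI, rule ccontr)
    fix s t assume st: "s \<in> T" "t \<in> T" "P s = P t" "s \<noteq> t"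
    then have "P s = {}" using disjoint_family_onD[OF P(2) st(1,2,4)] by auto
    with P(1) st(1) show False by (metis countable_empty)
  qed
  have ad0: "almost_disjoint (P ` T)"
    unfolding almost_disjoint_def
  proof (intro ballI impI)
    fix D E assume "D \<in> P ` T" "E \<in> P ` T" "D \<noteq> E"
    then obtain s t where "s \<in> T" "t \<in> T" "D = P s" "E = P t" "s \<noteq> t" by auto
    then show "countable (D \<inter> E)" using disjoint_family_onD[OF P(2), of s t] by simp
  qed
  have sub0: "P ` T \<subseteq> ?C" using P(1) by auto
  have uncC: "uncountable C" if "C \<in> ?C" for C using that by simp
  obtain \<D> where D: "P ` T \<subseteq> \<D>" "\<D> \<subseteq> ?C" "almost_disjoint \<D>"
    "\<forall>C\<in>?C. \<exists>D\<in>\<D>. uncountable (C \<inter> D)"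
    using maximal_almost_disjoint[OF sub0 ad0 uncC] .
  have unc: "uncountable \<D>"
    using D(1) assms countable_image_inj_on[OF _ inj] countable_subset by metis
  have "\<not> le_aleph1 \<D>"
  proof
    assume le: "le_aleph1 \<D>"
    have uncT: "uncountable (D \<inter> T)" if "D \<in> \<D>" for D
    proof -
      have "D \<subseteq> T" "uncountable D" using that D(2) by auto
      then show ?thesis by (simp add: Int_absorb2)
    qed
    obtain S where S: "S \<subseteq> T" "uncountable S" "\<forall>D\<in>\<D>. countable (S \<inter> D)"
      using almost_disjoint_diagonal[OF le unc D(3) uncT] .
    then have "\<exists>D\<in>\<D>. uncountable (S \<inter> D)" by (intro bspec[OF D(4)]) simp
    then show False using S(3) by auto
  qed
  with D(3,2) show ?thesis by (rule that)
qed

text \<open>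
  Run through \<open>A\<close> and keep a point unless the set attached to a point kept earlier covers it.
\<close>

lemma wf_greedy_subset:
  assumes "wf r"
  obtains D where "D \<subseteq> A" "\<forall>x\<in>D. \<forall>y\<in>D. (y, x) \<in> r \<longrightarrow> x \<notin> G y"
    "\<forall>x\<in>A. x \<in> D \<or> (\<exists>y\<in>D. x \<in> G y)"
proof -
  have "\<exists>d. \<forall>x. d x = (x \<in> A \<and> (\<forall>y. (y, x) \<in> r \<and> d y \<longrightarrow> x \<notin> G y))"
  proof (rule dependent_wf_choice[OF assms])
    fix d e :: "'a \<Rightarrow> bool" and x b
    assume "\<And>y. (y, x) \<in> r \<Longrightarrow> d y = e y"
    then have "(\<forall>y. (y, x) \<in> r \<and> d y \<longrightarrow> x \<notin> G y) = (\<forall>y. (y, x) \<in> r \<and> e y \<longrightarrow> x \<notin> G y)" by auto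
    then show "(b = (x \<in> A \<and> (\<forall>y. (y, x) \<in> r \<and> d y \<longrightarrow> x \<notin> G y))) =
      (b = (x \<in> A \<and> (\<forall>y. (y, x) \<in> r \<and> e y \<longrightarrow> x \<notin> G y)))" by simp
  qed auto
  then obtain d where d: "\<forall>x. d x = (x \<in> A \<and> (\<forall>y. (y, x) \<in> r \<and> d y \<longrightarrow> x \<notin> G y))" ..
  show ?thesis
  proof
    show "{x. d x} \<subseteq> A" using d by blast
    show "\<forall>x\<in>{x. d x}. \<forall>y\<in>{x. d x}. (y, x) \<in> r \<longrightarrow> x \<notin> G y" using d by blast
    show "\<forall>x\<in>A. x \<in> {x. d x} \<or> (\<exists>y\<in>{x. d x}. x \<in> G y)" using d by blast
  qed
qed

lemma large_trace_subset: "S \<subseteq> T \<Longrightarrow> large_trace \<D> S \<subseteq> large_trace \<D> T"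
proof
  fix D assume "S \<subseteq> T" "D \<in> large_trace \<D> S"
  then show "D \<in> large_trace \<D> T"
    unfolding large_trace_def by (auto dest: countable_subset[OF Int_mono[OF subset_refl]])
qed

lemma large_trace_UN:
  assumes "countable I" "S \<subseteq> (\<Union>i\<in>I. T i)"
  shows "large_trace \<D> S \<subseteq> (\<Union>i\<in>I. large_trace \<D> (T i))"
proof
  fix D assume D: "D \<in> large_trace \<D> S"
  show "D \<in> (\<Union>i\<in>I. large_trace \<D> (T i))"
  proof (rule ccontr)
    assume "\<not> ?thesis"
    then have "\<forall>i\<in>I. countable (D \<inter> T i)" using D by (auto simp: large_trace_def)
    then have "countable (\<Union>i\<in>I. D \<inter> T i)" using assms(1) by (intro countable_UN) auto
    moreover have "D \<inter> S \<subseteq> (\<Union>i\<in>I. D \<inter> T i)" using assms(2) by auto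
    ultimately have "countable (D \<inter> S)" by (meson countable_subset)
    with D show False by (simp add: large_trace_def)
  qed
qed

lemma large_trace_Un: "large_trace \<D> (S \<union> T) \<subseteq> large_trace \<D> S \<union> large_trace \<D> T"
  unfolding large_trace_def by (auto simp: Int_Un_distrib)

text \<open>
  Otherwise every subset of \<open>T\<close> that is covered by open sets with small trace on an almost disjoint
  family is already covered by countably many of them, because the points kept by the greedy choice
  form a locally countable set. So the family has a large trace on every open piece of the remaining
  part \<open>N\<close> of \<open>T\<close>, which is impossible.
\<close>

lemma exists_uncountable_locally_countable:
  assumes reg: "regular_space X" and HI: "hereditarily_irresolvable X U" and UX: "U \<subseteq> topspace X"
    and K: "K \<subseteq> U" "condensing X K" "le_aleph1 K"
    and T: "T \<subseteq> K" "uncountable T"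
  obtains D where "D \<subseteq> T" "uncountable D" "D \<inter> condensation_points X D = {}"
proof (rule ccontr)
  assume none: "\<not> thesis"
  obtain \<D> where D: "almost_disjoint \<D>" "\<D> \<subseteq> {D. D \<subseteq> T \<and> uncountable D}" "\<not> le_aleph1 \<D>"
    using exists_uncountable_almost_disjoint[OF T(2)] .
  define small where "small W \<longleftrightarrow> openin X W \<and> le_aleph1 (large_trace \<D> (W \<inter> T))" for W
  define S where "S = {x \<in> T. \<exists>W. small W \<and> x \<in> W}"
  obtain G where G: "\<forall>x\<in>S. small (G x) \<and> x \<in> G x"
    using bchoice[of S "\<lambda>x W. small W \<and> x \<in> W"] unfolding S_def by auto
  obtain r where r: "wf r" "total_on K r" "\<forall>x. countable {y. (y, x) \<in> r}"
    using le_aleph1_obtain_wf[OF K(3)] .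
  obtain E where E: "E \<subseteq> S" "\<forall>x\<in>E. \<forall>y\<in>E. (y, x) \<in> r \<longrightarrow> x \<notin> G y" "\<forall>x\<in>S. x \<in> E \<or> (\<exists>y\<in>E. x \<in> G y)"
    using wf_greedy_subset[OF r(1)] .
  have ST: "S \<subseteq> T" unfolding S_def by auto
  have "E \<inter> condensation_points X E = {}"
  proof (rule ccontr)
    assume "E \<inter> condensation_points X E \<noteq> {}"
    then obtain x where x: "x \<in> E" "x \<in> condensation_points X E" by auto
    then have "small (G x)" "x \<in> G x" using G E(1) by auto
    then have unc: "uncountable (G x \<inter> E)"
      using x(2) unfolding condensation_points_def small_def by simp
    have "G x \<inter> E \<subseteq> insert x {y. (y, x) \<in> r}"
    proof
      fix y assume y: "y \<in> G x \<inter> E"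
      then have "(x, y) \<notin> r" using E(2) x(1) by auto
      moreover have "x \<in> K" "y \<in> K" using x(1) y E(1) ST T(1) by auto
      ultimately show "y \<in> insert x {y. (y, x) \<in> r}" using r(2) unfolding total_on_def by auto
    qed
    moreover have "countable (insert x {y. (y, x) \<in> r})" using r(3) by simp
    ultimately show False using unc countable_subset by metis
  qed
  then have countE: "countable E" using none that E(1) ST by (meson subset_trans)
  have "S \<subseteq> (\<Union>y\<in>E. G y \<inter> T)" using E(3) G E(1) ST by fastforce
  then have "large_trace \<D> S \<subseteq> (\<Union>y\<in>E. large_trace \<D> (G y \<inter> T))" by (rule large_trace_UN[OF countE])
  moreover have "le_aleph1 (\<Union>y\<in>E. large_trace \<D> (G y \<inter> T))"
    by (rule le_aleph1_UN[OF le_aleph1_countable[OF countE]]) (use G E(1) in \<open>auto simp: small_def\<close>)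
  ultimately have smallS: "le_aleph1 (large_trace \<D> S)" by (rule le_aleph1_subset)
  define N where "N = T - S"
  \<comment> \<open>The points outside \<open>S\<close> see the large family \<open>\<D>\<close> in each of their neighbourhoods.\<close>
  have split: "A \<inter> T \<subseteq> (A \<inter> N) \<union> S" for A unfolding N_def by auto
  have "N \<noteq> {}"
  proof
    assume "N = {}"
    then have "T \<subseteq> S" unfolding N_def by auto
    moreover have "\<D> \<subseteq> large_trace \<D> T"
      using D(2) by (auto simp: large_trace_def Int_absorb2)
    ultimately have "\<D> \<subseteq> large_trace \<D> S" using large_trace_subset by (meson subset_trans)
    with D(3) smallS show False by (meson le_aleph1_subset)
  qed
  moreover have "\<not> le_aleph1 (large_trace \<D> (W \<inter> N))" if W: "openin X W" "W \<inter> N \<noteq> {}" for W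
  proof
    assume le: "le_aleph1 (large_trace \<D> (W \<inter> N))"
    have "large_trace \<D> (W \<inter> T) \<subseteq> large_trace \<D> (W \<inter> N) \<union> large_trace \<D> S"
      using large_trace_subset[OF split] large_trace_Un by (meson subset_trans)
    then have "le_aleph1 (large_trace \<D> (W \<inter> T))"
      using le_aleph1_Un[OF le smallS] by (rule le_aleph1_subset)
    then have "small W" using W(1) by (simp add: small_def)
    then have "W \<inter> T \<subseteq> S" unfolding S_def by auto
    with W(2) show False unfolding N_def by auto
  qed
  moreover have "N \<subseteq> K" using T(1) unfolding N_def by auto
  ultimately show False
    using almost_disjoint_large_traces_contradiction[OF reg HI K _ _ UX D(1), of N] by metis
qed

text \<open>
  A maximal almost disjoint family of locally countable sets has a small trace on some open piece of
  \<open>K\<close>. By the diagonal argument this trace is countable, so the piece is the union of a countable set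
  and of countably many locally countable sets \<open>D\<^sub>0, D\<^sub>1, \<dots>\<close>. Order the piece by the index of
  these sets. On a smaller open set no point is in the closure of the points of smaller index. The
  first \<open>D\<^sub>n\<close> with an uncountable trace can then condense neither at points of larger
  index nor in itself, hence only at the countably many points of smaller index.
\<close>

lemma small_crowded_condensing_imp_concentrated:
  assumes reg: "regular_space X" and HI: "hereditarily_irresolvable X U" and UX: "U \<subseteq> topspace X"
    and K: "K \<subseteq> U" "condensing X K" "le_aleph1 K" and K0: "K \<noteq> {}" and crowded: "uncountably_crowded X K"
  shows "\<exists>T Q. T \<subseteq> K \<and> Q \<subseteq> K \<and> concentrated_pair X T Q"
proof (rule ccontr)
  assume none: "\<not> ?thesis"
  let ?C = "{D. D \<subseteq> K \<and> uncountable D \<and> D \<inter> condensation_points X D = {}}"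
  have uncC: "uncountable C" if "C \<in> ?C" for C using that by simp
  have empty: "almost_disjoint ({} :: 'a set set)" by (simp add: almost_disjoint_def)
  obtain \<D> where D: "{} \<subseteq> \<D>" "\<D> \<subseteq> ?C" "almost_disjoint \<D>" "\<forall>C\<in>?C. \<exists>D\<in>\<D>. uncountable (C \<inter> D)"
    using maximal_almost_disjoint[OF empty_subsetI empty uncC] .
  have hit: "\<exists>D\<in>\<D>. uncountable (T \<inter> D)" if T: "T \<subseteq> K" "uncountable T" for T
  proof -
    obtain E where E: "E \<subseteq> T" "uncountable E" "E \<inter> condensation_points X E = {}"
      using exists_uncountable_locally_countable[OF reg HI UX K T] .
    then have "E \<in> ?C" using T(1) by auto
    then have "\<exists>D\<in>\<D>. uncountable (E \<inter> D)" by (rule bspec[OF D(4)])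
    then obtain D where "D \<in> \<D>" "uncountable (E \<inter> D)" by auto
    moreover have "E \<inter> D \<subseteq> T \<inter> D" using E(1) by auto
    ultimately show ?thesis by (meson countable_subset)
  qed
  obtain W where W: "openin X W" "W \<inter> K \<noteq> {}" "le_aleph1 (large_trace \<D> (W \<inter> K))"
    using almost_disjoint_large_traces_contradiction[OF reg HI K subset_refl K0 UX D(3)] by metis
  define H where "H = large_trace \<D> (W \<inter> K)"
  have HD: "H \<subseteq> \<D>" unfolding H_def large_trace_def by auto
  have "countable H"
  proof (rule ccontr)
    assume unc: "uncountable H"
    have adH: "almost_disjoint H" using D(3) HD unfolding almost_disjoint_def by (meson subsetD)
    have uncH: "uncountable (D \<inter> (W \<inter> K))" if "D \<in> H" for D
      using that unfolding H_def large_trace_def by simp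
    obtain T where T: "T \<subseteq> W \<inter> K" "uncountable T" "\<forall>D\<in>H. countable (T \<inter> D)"
      using almost_disjoint_diagonal[OF W(3)[folded H_def] unc adH uncH] .
    then obtain D where DD: "D \<in> \<D>" "uncountable (T \<inter> D)" using hit[of T] by auto
    have "T \<inter> D \<subseteq> D \<inter> (W \<inter> K)" using T(1) by auto
    then have "uncountable (D \<inter> (W \<inter> K))" using DD(2) by (meson countable_subset)
    then have "D \<in> H" using DD(1) by (simp add: H_def large_trace_def)
    with T(3) DD(2) show False by auto
  qed
  have rest: "countable (W \<inter> K - \<Union>H)"
  proof (rule ccontr)
    assume unc: "uncountable (W \<inter> K - \<Union>H)"
    then obtain D where DD: "D \<in> \<D>" "uncountable ((W \<inter> K - \<Union>H) \<inter> D)" using hit[of "W \<inter> K - \<Union>H"] by auto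
    have "(W \<inter> K - \<Union>H) \<inter> D \<subseteq> D \<inter> (W \<inter> K)" by auto
    then have "uncountable (D \<inter> (W \<inter> K))" using DD(2) by (meson countable_subset)
    then have "D \<in> H" using DD(1) by (simp add: H_def large_trace_def)
    then have "(W \<inter> K - \<Union>H) \<inter> D = {}" by auto
    with DD(2) show False by simp
  qed
  define e where "e = from_nat_into H"
  \<comment> \<open>Rank 0 is left for the countable remainder, which belongs to no set of \<open>H\<close>.\<close>
  define rank where "rank x = (if x \<in> \<Union>H then Suc (LEAST n. x \<in> e n) else 0)" for x
  let ?G = "W \<inter> K"
  have GU: "?G \<subseteq> U" using K(1) by auto
  obtain V where V: "openin X V" "V \<inter> ?G \<noteq> {}"
    "\<forall>x\<in>V \<inter> ?G. x \<notin> X closure_of {y \<in> ?G. (y, x) \<in> inv_image less_than rank}"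
    using hereditarily_irresolvable_avoid_predecessors[OF HI UX GU W(2) wf_inv_image[OF wf_less_than]] .
  then obtain x0 where x0: "x0 \<in> V \<inter> W" "x0 \<in> K" by auto
  have "openin X (V \<inter> W)" using V(1) W(1) by auto
  then obtain V' C where C: "openin X V'" "closedin X C" "x0 \<in> V'" "V' \<subseteq> C" "C \<subseteq> V \<inter> W"
    using regular_space_shrink[OF reg _ x0(1)] by metis
  \<comment> \<open>By induction on the rank: were the points of rank \<open>n\<close> uncountable, they would be concentrated
    on the countable set of points of smaller rank.\<close>
  have "countable {x \<in> C \<inter> K. rank x < n}" for n
  proof (induction n)
    case (Suc n)
    let ?Q = "{x \<in> C \<inter> K. rank x < n}" and ?T = "{x \<in> C \<inter> K. rank x = n}"
    have "countable ?T"
    proof (cases n)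
      case 0
      then have "?T \<subseteq> W \<inter> K - \<Union>H" using C(5) by (auto simp: rank_def split: if_splits)
      then show ?thesis using rest by (rule countable_subset)
    next
      case (Suc m)
      show ?thesis
      proof (rule ccontr)
        assume unc: "uncountable ?T"
        have Te: "x \<in> e m \<and> e m \<in> H" if "x \<in> ?T" for x
        proof -
          have xH: "x \<in> \<Union>H" and m: "m = (LEAST n. x \<in> e n)"
            using that Suc by (auto simp: rank_def split: if_splits)
          then have "H \<noteq> {}" by auto
          then have "range e = H" unfolding e_def using \<open>countable H\<close> by (rule range_from_nat_into)
          then have "\<exists>n. x \<in> e n" using xH by auto
          then have "x \<in> e m" unfolding m by (rule LeastI_ex)
          with \<open>range e = H\<close> show ?thesis by auto
        qed
        \<comment> \<open>A condensation point \<open>q\<close> is excluded from rank above \<open>n\<close> by the choice of \<open>V\<close>, and from rank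
          \<open>n\<close> because \<open>e m\<close> is locally countable.\<close>
        have "concentrated_pair X ?T ?Q"
          unfolding concentrated_pair_def
        proof (intro conjI allI impI)
          fix S assume S: "S \<subseteq> ?T" "uncountable S"
          then have "S \<subseteq> K" by auto
          then obtain q where q: "q \<in> K" "q \<in> condensation_points X S"
            using condensingE[OF K(2) _ S(2)] by metis
          have "S \<subseteq> C" using S(1) by auto
          then have qC: "q \<in> C" using condensation_points_closedin[OF C(2)] q(2) by auto
          then have qV: "q \<in> V \<inter> ?G" using C(5) q(1) by auto
          have "\<not> n < rank q"
          proof
            assume "n < rank q"
            then have "S \<subseteq> {y \<in> ?G. (y, q) \<in> inv_image less_than rank}" using S(1) C(5) by auto
            then have "q \<in> X closure_of {y \<in> ?G. (y, q) \<in> inv_image less_than rank}"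
              using q(2) condensation_points_subset_closure closure_of_mono by (metis subsetD)
            with bspec[OF V(3) qV] show False by simp
          qed
          moreover have "rank q \<noteq> n"
          proof
            assume "rank q = n"
            then have "q \<in> ?T" using qC q(1) by auto
            then have qe: "q \<in> e m" "e m \<in> H" using Te by auto
            have "S \<subseteq> e m" using S(1) Te by blast
            then have "q \<in> condensation_points X (e m)" using q(2) condensation_points_mono by (metis subsetD)
            moreover have "e m \<inter> condensation_points X (e m) = {}" using qe(2) HD D(2) by auto
            ultimately show False using qe(1) by auto
          qed
          ultimately have "q \<in> ?Q" using qC q(1) by auto
          with q(2) show "condensation_points X S \<inter> ?Q \<noteq> {}" by auto
        qed (use unc Suc.IH in auto)
        moreover have "?T \<subseteq> K" "?Q \<subseteq> K" by auto
        ultimately show False using none by blast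
      qed
    qed
    then have "countable (?Q \<union> ?T)" using Suc.IH by simp
    then show ?case by (rule countable_subset[rotated]) auto
  qed simp
  then have "countable (\<Union>n. {x \<in> C \<inter> K. rank x < n})" by (intro countable_UN) auto
  moreover have "V' \<inter> K \<subseteq> (\<Union>n. {x \<in> C \<inter> K. rank x < n})" using C(4) by auto
  ultimately have "countable (V' \<inter> K)" by (meson countable_subset)
  moreover have "uncountable (V' \<inter> K)"
    using crowded C(1,3) x0(2) unfolding uncountably_crowded_def by auto
  ultimately show False by simp
qed

text \<open>
  Reduction to size aleph-one. For an arbitrary well-order there is an open set in which no point
  of the crowded part is in the closure of its predecessors. In a closed neighbourhood inside it,
  the initial segment \<open>Y\<close> of type \<open>\<omega>\<^sub>1\<close> is therefore relatively closed, and so again condensing.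
\<close>

lemma condensing_imp_concentrated:
  assumes reg: "regular_space X" and HI: "hereditarily_irresolvable X U" and UX: "U \<subseteq> topspace X"
    and P: "P \<subseteq> U" "condensing X P" "uncountable P"
  shows "\<exists>T Q. T \<subseteq> P \<and> Q \<subseteq> P \<and> concentrated_pair X T Q"
proof (rule ccontr)
  assume none: "\<not> ?thesis"
  have PX: "P \<subseteq> topspace X" using P(1) UX by auto
  obtain K where K: "K \<subseteq> P" "K \<noteq> {}" "condensing X K" "uncountably_crowded X K"
    using condensing_crowded_or_concentrated[OF reg PX P(3,2)] none by auto
  have KU: "K \<subseteq> U" using K(1) P(1) by auto
  obtain r where r: "well_order_on UNIV (r :: 'a rel)" using well_order_on by blast
  then have wf: "wf (r - Id)" and tot: "total (r - Id)"
    by (auto simp: well_order_on_def linear_order_on_def total_on_def)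
  obtain W where W: "openin X W" "W \<inter> K \<noteq> {}"
    "\<forall>x\<in>W \<inter> K. x \<notin> X closure_of {y \<in> K. (y, x) \<in> r - Id}"
    using hereditarily_irresolvable_avoid_predecessors[OF HI UX KU K(2) wf] .
  then obtain x0 where x0: "x0 \<in> W" "x0 \<in> K" by auto
  obtain V C where C: "openin X V" "closedin X C" "x0 \<in> V" "V \<subseteq> C" "C \<subseteq> W"
    using regular_space_shrink[OF reg W(1) x0(1)] .
  define Y where "Y = {x \<in> C \<inter> K. countable {y \<in> C \<inter> K. (y, x) \<in> r - Id}}"
  have trans: "(x, z) \<in> r - Id" if "(x, y) \<in> r - Id" "(y, z) \<in> r - Id" for x y z
    using that r unfolding well_order_on_def linear_order_on_def partial_order_on_def preorder_on_def
    by (auto dest: transD antisymD)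
  have later: "(y, x) \<in> r - Id" if "y \<in> Y" "x \<in> C \<inter> K" "x \<notin> Y" for x y
  proof -
    have "x \<noteq> y" using that by auto
    moreover have "(x, y) \<notin> r - Id"
    proof
      assume "(x, y) \<in> r - Id"
      then have "{z \<in> C \<inter> K. (z, x) \<in> r - Id} \<subseteq> {z \<in> C \<inter> K. (z, y) \<in> r - Id}" using trans by blast
      then have "countable {z \<in> C \<inter> K. (z, x) \<in> r - Id}"
        using that(1) unfolding Y_def by (auto dest: countable_subset)
      with that(2,3) show False unfolding Y_def by simp
    qed
    ultimately show ?thesis using tot unfolding total_on_def by auto
  qed
  have YC: "Y \<subseteq> C \<inter> K" unfolding Y_def by auto
  have "uncountable Y"
  proof
    assume count: "countable Y"
    have "uncountable (V \<inter> K)" using K(4) C(1,3) x0(2) unfolding uncountably_crowded_def by auto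
    moreover have "V \<inter> K \<subseteq> C \<inter> K" using C(4) by auto
    ultimately have "\<not> C \<inter> K \<subseteq> Y" using count by (meson countable_subset)
    then obtain a where "a \<in> C \<inter> K - Y" by auto
    then obtain x where x: "x \<in> C \<inter> K - Y" "\<And>y. (y, x) \<in> r - Id \<Longrightarrow> y \<notin> C \<inter> K - Y"
      using wfE_min[OF wf] by metis
    then have "{y \<in> C \<inter> K. (y, x) \<in> r - Id} \<subseteq> Y" by auto
    then have "countable {y \<in> C \<inter> K. (y, x) \<in> r - Id}" using count by (rule countable_subset)
    with x(1) show False unfolding Y_def by auto
  qed
  moreover have "le_aleph1 Y"
  proof (rule le_aleph1_if_countable_predecessors)
    show "total_on Y (r - Id)" using tot unfolding total_on_def by auto
    fix x assume "x \<in> Y"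
    then have "countable {y \<in> C \<inter> K. (y, x) \<in> r - Id}" unfolding Y_def by auto
    then show "countable {y \<in> Y. (y, x) \<in> r - Id}" by (rule countable_subset[rotated]) (use YC in auto)
  qed
  moreover have "condensing X Y"
  proof (rule condensing_relatively_closed[OF condensing_Int_closedin[OF K(3) C(2)] YC], rule ccontr)
    assume "\<not> (C \<inter> K) \<inter> X closure_of Y \<subseteq> Y"
    then obtain x where x: "x \<in> C \<inter> K" "x \<in> X closure_of Y" "x \<notin> Y" by auto
    have "Y \<subseteq> {y \<in> K. (y, x) \<in> r - Id}" using later x(1,3) YC by auto
    then have "x \<in> X closure_of {y \<in> K. (y, x) \<in> r - Id}" using x(2) closure_of_mono by (metis subsetD)
    with bspec[OF W(3), of x] x(1) C(5) show False by auto
  qed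
  moreover have YP: "Y \<subseteq> P" using YC K(1) by auto
  moreover have noneY: "\<not> (\<exists>T Q. T \<subseteq> Y \<and> Q \<subseteq> Y \<and> concentrated_pair X T Q)"
    using none YP by (meson subset_trans)
  ultimately obtain L where L: "L \<subseteq> Y" "L \<noteq> {}" "condensing X L" "uncountably_crowded X L"
    using condensing_crowded_or_concentrated[OF reg subset_trans[OF YP PX]] by auto
  have "L \<subseteq> U" "le_aleph1 L" using L(1) YP P(1) le_aleph1_subset[OF L(1) \<open>le_aleph1 Y\<close>] by auto
  then obtain T Q where "T \<subseteq> L" "Q \<subseteq> L" "concentrated_pair X T Q"
    using small_crowded_condensing_imp_concentrated[OF reg HI UX _ L(3) _ L(2,4)] by auto
  with L(1) noneY show False by (meson subset_trans)
qed

section \<open>A space in which concentrated pairs are dense\<close>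

text \<open>
  Cut \<open>T\<close> into uncountably many uncountable pieces. Points of the countable set \<open>Q\<close> at which only
  countably many pieces condense can be avoided by dropping countably many pieces. The points left
  over, which form \<open>R\<close>, have uncountably many pieces each, enough to give each of them two pieces of
  its own.
\<close>

lemma concentrated_pair_split:
  assumes T: "concentrated_pair X T Q"
  obtains S0 S1 R where "S0 \<union> S1 \<subseteq> T" "S0 \<inter> S1 = {}" "R \<subseteq> Q" "concentrated_pair X (S0 \<union> S1) R"
    "R \<subseteq> condensation_points X S0" "R \<subseteq> condensation_points X S1"
proof -
  have uncT: "uncountable T" and Q: "countable Q"
    and conc: "\<And>S. S \<subseteq> T \<Longrightarrow> uncountable S \<Longrightarrow> condensation_points X S \<inter> Q \<noteq> {}"
    using T unfolding concentrated_pair_def by auto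
  obtain P where P: "\<forall>t\<in>T. P t \<subseteq> T \<and> uncountable (P t)" "disjoint_family_on P T"
    using uncountable_partition[OF uncT] .
  define I where "I q = {t \<in> T. q \<in> condensation_points X (P t)}" for q
  define R where "R = {q \<in> Q. uncountable (I q)}"
  define bad where "bad = (\<Union>q\<in>Q - R. I q)"
  have bad: "countable bad"
    unfolding bad_def by (rule countable_UN) (use Q in \<open>auto simp: R_def\<close>)
  have RQ: "R \<subseteq> Q" unfolding R_def by auto
  have catch: "q \<in> R" if "t \<in> T - bad" "q \<in> Q" "q \<in> condensation_points X (P t)" for t q
    using that unfolding bad_def I_def by auto
  let ?J = "R \<times> (UNIV :: bool set)"
  have J: "countable ?J" using Q RQ by (auto intro: countable_subset)
  have "\<not> |I (fst i) - bad| \<le>o |?J|" if "i \<in> ?J" for i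
  proof
    assume "|I (fst i) - bad| \<le>o |?J|"
    then have "countable (I (fst i) - bad)"
      using J ordLeq_transitive unfolding countable_iff_ordLeq_natLeq by metis
    then have "countable (I (fst i))" using uncountable_minus_countable[OF _ bad] by auto
    with that show False by (auto simp: R_def)
  qed
  then obtain h where inj: "inj_on h ?J" and h: "\<forall>i\<in>?J. h i \<in> I (fst i) - bad"
    by (rule injective_choice)
  define S where "S b = (\<Union>q\<in>R. P (h (q, b)))" for b
  have hT: "h i \<in> T - bad" if "i \<in> ?J" for i using h[rule_format, OF that] by (simp add: I_def)
  have R_cond: "R \<subseteq> condensation_points X (S b)" for b
  proof
    fix q assume q: "q \<in> R"
    then have "q \<in> condensation_points X (P (h (q, b)))" using h by (auto simp: I_def)
    moreover have "P (h (q, b)) \<subseteq> S b" using q unfolding S_def by auto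
    ultimately show "q \<in> condensation_points X (S b)" using condensation_points_mono by (metis subsetD)
  qed
  have ST: "S b \<subseteq> T" for b
  proof
    fix x assume "x \<in> S b"
    then obtain q where "q \<in> R" "x \<in> P (h (q, b))" unfolding S_def by auto
    then show "x \<in> T" using P(1) hT[of "(q, b)"] by auto
  qed
  have "S True \<inter> S False = {}"
  proof (rule ccontr)
    assume "S True \<inter> S False \<noteq> {}"
    then obtain x p q where x: "p \<in> R" "q \<in> R" "x \<in> P (h (p, True))" "x \<in> P (h (q, False))"
      unfolding S_def by auto
    have "h (p, True) \<noteq> h (q, False)" using inj x(1,2) unfolding inj_on_def by auto
    then have "P (h (p, True)) \<inter> P (h (q, False)) = {}"
      using hT[of "(p, True)"] hT[of "(q, False)"] x(1,2) by (intro disjoint_family_onD[OF P(2)]) auto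
    with x(3,4) show False by auto
  qed
  moreover have "concentrated_pair X (S True \<union> S False) R"
    unfolding concentrated_pair_def
  proof (intro conjI allI impI)
    show "countable R" using Q RQ by (rule countable_subset[rotated])
    have "\<not> T \<subseteq> bad" using uncT bad by (meson countable_subset)
    then obtain t where t: "t \<in> T - bad" by auto
    then have "condensation_points X (P t) \<inter> Q \<noteq> {}" using conc[of "P t"] P(1) by simp
    then obtain q where "q \<in> R" using catch[OF t] by auto
    then have "h (q, True) \<in> T" "P (h (q, True)) \<subseteq> S True" using hT[of "(q, True)"] unfolding S_def by auto
    moreover then have "uncountable (P (h (q, True)))" using P(1) by simp
    moreover have "P (h (q, True)) \<subseteq> S True \<union> S False" using calculation(2) by auto
    ultimately show "uncountable (S True \<union> S False)" by (meson countable_subset)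
    fix A assume A: "A \<subseteq> S True \<union> S False" "uncountable A"
    have "A \<subseteq> (\<Union>i\<in>?J. A \<inter> P (h i))"
    proof
      fix x assume x: "x \<in> A"
      then obtain b where "x \<in> S b" using A(1) by auto
      then obtain q where "(q, b) \<in> ?J" "x \<in> P (h (q, b))" unfolding S_def by auto
      with x show "x \<in> (\<Union>i\<in>?J. A \<inter> P (h i))" by blast
    qed
    then have "\<not> countable (\<Union>i\<in>?J. A \<inter> P (h i))" using A(2) by (meson countable_subset)
    then obtain i where i: "i \<in> ?J" "uncountable (A \<inter> P (h i))" using J countable_UN by metis
    have "A \<inter> P (h i) \<subseteq> T" using P(1) hT[OF i(1)] by auto
    then obtain q where q: "q \<in> Q" "q \<in> condensation_points X (A \<inter> P (h i))" using conc[OF _ i(2)] by auto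
    have "q \<in> condensation_points X (P (h i))" "q \<in> condensation_points X A"
      using q(2) condensation_points_mono[of "A \<inter> P (h i)"] by auto
    with catch[OF hT[OF i(1)] q(1)] show "condensation_points X A \<inter> R \<noteq> {}" by auto
  qed
  ultimately show ?thesis using ST RQ R_cond by (intro that[of "S True" "S False" R]) auto
qed

text \<open>
  The points at which some small concentrated pair condenses are dense, and in a hereditarily
  irresolvable set a dense set contains a non-empty open set.
\<close>

lemma concentrated_pairs_near_points:
  assumes reg: "regular_space X" and HI: "hereditarily_irresolvable X U"
    and U: "openin X U" "U \<noteq> {}"
    and dense: "\<And>V. openin X V \<Longrightarrow> V \<subseteq> U \<Longrightarrow> V \<noteq> {} \<Longrightarrow> \<exists>T Q. T \<subseteq> V \<and> Q \<subseteq> V \<and> concentrated_pair X T Q"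
  obtains V where "openin X V" "V \<noteq> {}" "V \<subseteq> U"
    "\<forall>q\<in>V. \<exists>T Q. T \<subseteq> V \<and> Q \<subseteq> V \<and> concentrated_pair X T Q \<and> le_aleph1 T \<and> q \<in> condensation_points X T"
proof -
  define G where "G = {q \<in> U. \<exists>T Q. concentrated_pair X T Q \<and> T \<subseteq> U \<and> Q \<subseteq> U \<and> le_aleph1 T \<and> q \<in> condensation_points X T}"
  have UX: "U \<subseteq> topspace X" using U(1) by (rule openin_subset)
  have G_dense: "V \<inter> G \<noteq> {}" if V: "openin X V" "V \<subseteq> U" "V \<noteq> {}" for V
  proof -
    obtain T Q where TQ: "T \<subseteq> V" "Q \<subseteq> V" "concentrated_pair X T Q" using dense[OF V] by auto
    then have "uncountable T" by (simp add: concentrated_pair_def)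
    then obtain S where S: "S \<subseteq> T" "uncountable S" "le_aleph1 S"
      by (rule uncountable_obtain_le_aleph1_subset)
    have pair: "concentrated_pair X S Q" using concentrated_pair_subset[OF TQ(3) S(1,2)] .
    have "condensation_points X S \<inter> Q \<noteq> {}" using TQ(3) S(1,2) by (simp add: concentrated_pair_def)
    then obtain q where q: "q \<in> condensation_points X S" "q \<in> Q" by auto
    have "S \<subseteq> U" "Q \<subseteq> U" using S(1) TQ(1,2) V(2) by auto
    then have "q \<in> G" unfolding G_def using pair S(3) q by auto
    with q(2) TQ(2) show ?thesis by auto
  qed
  have GU: "G \<subseteq> U" unfolding G_def by auto
  have U_cl: "U \<subseteq> X closure_of G"
  proof
    fix x assume x: "x \<in> U"
    have "\<exists>y. y \<in> G \<and> y \<in> W" if "x \<in> W \<and> openin X W" for W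
      using G_dense[of "W \<inter> U"] U(1) that x by auto
    then show "x \<in> X closure_of G" using x UX by (auto simp: in_closure_of)
  qed
  have "\<not> U \<subseteq> X closure_of (U - G)"
  proof
    assume "U \<subseteq> X closure_of (U - G)"
    then have "G = {}"
      using GU U_cl by (intro hereditarily_irresolvableD[OF HI, of G "U - G"]) auto
    with G_dense[OF U(1) subset_refl U(2)] show False by simp
  qed
  define V where "V = U - X closure_of (U - G)"
  have V: "openin X V" "V \<noteq> {}" "V \<subseteq> U"
    using \<open>\<not> U \<subseteq> X closure_of (U - G)\<close> U(1) unfolding V_def by (auto intro: openin_diff)
  have "U - G \<subseteq> X closure_of (U - G)" using UX by (intro closure_of_subset) auto
  then have VG: "V \<subseteq> G" unfolding V_def by auto
  have "\<exists>T Q. T \<subseteq> V \<and> Q \<subseteq> V \<and> concentrated_pair X T Q \<and> le_aleph1 T \<and> q \<in> condensation_points X T"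
    if q: "q \<in> V" for q
  proof -
    obtain T Q where TQ: "concentrated_pair X T Q" "le_aleph1 T" "q \<in> condensation_points X T"
      using q VG unfolding G_def by auto
    obtain W C where C: "openin X W" "closedin X C" "q \<in> W" "W \<subseteq> C" "C \<subseteq> V"
      using regular_space_shrink[OF reg V(1) q] .
    have "uncountable (O' \<inter> (T \<inter> C))" if O': "openin X O'" "q \<in> O'" for O'
    proof -
      have "uncountable ((O' \<inter> W) \<inter> T)"
        using TQ(3) O' C(1,3) by (auto simp: condensation_points_def)
      moreover have "(O' \<inter> W) \<inter> T \<subseteq> O' \<inter> (T \<inter> C)" using C(4) by auto
      ultimately show ?thesis by (meson countable_subset)
    qed
    then have cond: "q \<in> condensation_points X (T \<inter> C)"
      using TQ(3) by (auto simp: condensation_points_def)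
    then have "uncountable (W \<inter> (T \<inter> C))" using C(1,3) by (simp add: condensation_points_def)
    then have "uncountable (T \<inter> C)" by (meson countable_subset inf_le2)
    then have "concentrated_pair X (T \<inter> C) (Q \<inter> C)"
      by (rule concentrated_pair_Int_closedin[OF TQ(1) C(2)])
    moreover have "le_aleph1 (T \<inter> C)" by (rule le_aleph1_subset[OF _ TQ(2)]) auto
    ultimately show ?thesis using cond C(5) by (intro exI[of _ "T \<inter> C"] exI[of _ "Q \<inter> C"]) auto
  qed
  then show ?thesis using V by (intro that[of V]) auto
qed

lemma le_aleph1_closure_under:
  assumes F: "\<And>x. x \<in> V \<Longrightarrow> F x \<subseteq> V \<and> le_aleph1 (F x)" and a: "a \<in> V"
  obtains Y where "Y \<subseteq> V" "a \<in> Y" "le_aleph1 Y" "\<forall>x\<in>Y. F x \<subseteq> Y"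
proof -
  define Z where "Z n = ((\<lambda>A. A \<union> (\<Union>x\<in>A. F x)) ^^ n) {a}" for n
  have Z0: "Z 0 = {a}" and ZS: "Z (Suc n) = Z n \<union> (\<Union>x\<in>Z n. F x)" for n
    unfolding Z_def by auto
  have Z: "Z n \<subseteq> V \<and> le_aleph1 (Z n)" for n
  proof (induction n)
    case 0
    then show ?case using a by (simp add: Z0 le_aleph1_countable)
  next
    case (Suc n)
    have "le_aleph1 (\<Union>x\<in>Z n. F x)" by (rule le_aleph1_UN) (use Suc F in auto)
    then have "le_aleph1 (Z (Suc n))" unfolding ZS using Suc by (intro le_aleph1_Un) auto
    moreover have "Z (Suc n) \<subseteq> V" unfolding ZS using Suc F by auto
    ultimately show ?case by simp
  qed
  show ?thesis
  proof
    show "(\<Union>n. Z n) \<subseteq> V" using Z by auto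
    show "a \<in> (\<Union>n. Z n)" using Z0 by auto
    show "le_aleph1 (\<Union>n. Z n)" by (rule le_aleph1_UN) (use Z in \<open>auto intro: le_aleph1_countable\<close>)
    show "\<forall>x\<in>\<Union>n. Z n. F x \<subseteq> (\<Union>n. Z n)"
    proof
      fix x assume "x \<in> (\<Union>n. Z n)"
      then obtain n where "x \<in> Z n" by auto
      then have "F x \<subseteq> Z (Suc n)" unfolding ZS by auto
      then show "F x \<subseteq> (\<Union>n. Z n)" by auto
    qed
  qed
qed

text \<open>
  Close a point off to a set \<open>Y\<close> of size aleph-one that contains a concentrated pair near each of
  its points. Take a maximal almost disjoint family of split pairs in \<open>Y\<close>. Its countable limit sets
  are dense in \<open>Y\<close>, since every other split pair meets a member of the family in an uncountable set,
  which condenses at the limit set of that member. Choosing one member for every limit point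
  leaves at most aleph-one members, which can be made disjoint, and the two halves of each
  then form two disjoint dense subsets.
\<close>

lemma concentrated_pairs_dense_contradiction:
  assumes reg: "regular_space X" and HI: "hereditarily_irresolvable X U"
    and U: "openin X U" "U \<noteq> {}"
    and dense: "\<And>V. openin X V \<Longrightarrow> V \<subseteq> U \<Longrightarrow> V \<noteq> {} \<Longrightarrow> \<exists>T Q. T \<subseteq> V \<and> Q \<subseteq> V \<and> concentrated_pair X T Q"
  shows False
proof -
  have UX: "U \<subseteq> topspace X" using U(1) by (rule openin_subset)
  obtain V where V: "openin X V" "V \<noteq> {}" "V \<subseteq> U"
    "\<forall>q\<in>V. \<exists>T Q. T \<subseteq> V \<and> Q \<subseteq> V \<and> concentrated_pair X T Q \<and> le_aleph1 T \<and> q \<in> condensation_points X T"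
    using concentrated_pairs_near_points[OF reg HI U dense] .
  obtain t where "\<forall>q\<in>V. \<exists>Q. t q \<subseteq> V \<and> Q \<subseteq> V \<and> concentrated_pair X (t q) Q \<and> le_aleph1 (t q) \<and> q \<in> condensation_points X (t q)"
    using bchoice[OF V(4)] ..
  from bchoice[OF this] obtain s where ts: "\<forall>q\<in>V. t q \<subseteq> V \<and> s q \<subseteq> V \<and> concentrated_pair X (t q) (s q) \<and>
      le_aleph1 (t q) \<and> q \<in> condensation_points X (t q)" ..
  obtain a where a: "a \<in> V" using V(2) by auto
  have F: "t q \<union> s q \<subseteq> V \<and> le_aleph1 (t q \<union> s q)" if "q \<in> V" for q
  proof -
    have q: "t q \<subseteq> V" "s q \<subseteq> V" "countable (s q)" "le_aleph1 (t q)"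
      using ts that by (auto simp: concentrated_pair_def)
    then have "le_aleph1 (t q \<union> s q)" by (intro le_aleph1_Un le_aleph1_countable[of "s q"])
    with q show ?thesis by simp
  qed
  obtain Y where Y: "Y \<subseteq> V" "a \<in> Y" "le_aleph1 Y" "\<forall>q\<in>Y. t q \<union> s q \<subseteq> Y"
    using le_aleph1_closure_under[of V "\<lambda>q. t q \<union> s q", OF F a] .
  define split where "split S S0 S1 R \<longleftrightarrow> S = S0 \<union> S1 \<and> S0 \<inter> S1 = {} \<and> S \<subseteq> Y \<and> R \<subseteq> Y \<and> concentrated_pair X S R \<and>
    R \<subseteq> condensation_points X S0 \<and> R \<subseteq> condensation_points X S1" for S S0 S1 R
  let ?C = "{S. \<exists>S0 S1 R. split S S0 S1 R}"
  have uncC: "uncountable S" if "S \<in> ?C" for S using that by (auto simp: split_def concentrated_pair_def)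
  have empty: "almost_disjoint ({} :: 'a set set)" by (simp add: almost_disjoint_def)
  obtain \<D> where D: "{} \<subseteq> \<D>" "\<D> \<subseteq> ?C" "almost_disjoint \<D>" "\<forall>C\<in>?C. \<exists>D\<in>\<D>. uncountable (C \<inter> D)"
    using maximal_almost_disjoint[OF empty_subsetI empty uncC] .
  have "\<forall>S\<in>?C. \<exists>p. split S (fst p) (fst (snd p)) (snd (snd p))" by simp
  from bchoice[OF this] obtain p where p: "\<forall>S\<in>?C. split S (fst (p S)) (fst (snd (p S))) (snd (snd (p S)))" ..
  define red where "red S = fst (p S)" for S
  define blue where "blue S = fst (snd (p S))" for S
  define lim where "lim S = snd (snd (p S))" for S
  have sp: "split S (red S) (blue S) (lim S)" if "S \<in> \<D>" for S
    using p D(2) that unfolding red_def blue_def lim_def by blast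
  define J where "J = (\<Union>S\<in>\<D>. lim S)"
  have JY: "J \<subseteq> Y" unfolding J_def using sp by (auto simp: split_def)
  have YX: "Y \<subseteq> topspace X" using Y(1) V(3) UX by auto
  have "Y \<subseteq> X closure_of J"
  proof
    fix q assume q: "q \<in> Y"
    have "\<exists>y. y \<in> J \<and> y \<in> W" if W: "q \<in> W \<and> openin X W" for W
    proof -
      obtain W' C where C: "openin X W'" "closedin X C" "q \<in> W'" "W' \<subseteq> C" "C \<subseteq> W"
        using regular_space_shrink[OF reg] W by metis
      have tq: "concentrated_pair X (t q) (s q)" "q \<in> condensation_points X (t q)" "t q \<subseteq> Y" "s q \<subseteq> Y"
        using ts Y(1,4) q by auto
      have "uncountable (W' \<inter> t q)" using tq(2) C(1,3) by (simp add: condensation_points_def)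
      moreover have "W' \<inter> t q \<subseteq> t q \<inter> C" using C(4) by auto
      ultimately have "uncountable (t q \<inter> C)" by (meson countable_subset)
      then have "concentrated_pair X (t q \<inter> C) (s q \<inter> C)"
        by (rule concentrated_pair_Int_closedin[OF tq(1) C(2)])
      then obtain S0 S1 R where R: "S0 \<union> S1 \<subseteq> t q \<inter> C" "S0 \<inter> S1 = {}" "R \<subseteq> s q \<inter> C"
        "concentrated_pair X (S0 \<union> S1) R" "R \<subseteq> condensation_points X S0" "R \<subseteq> condensation_points X S1"
        by (rule concentrated_pair_split)
      have "split (S0 \<union> S1) S0 S1 R" unfolding split_def using R tq(3,4) by auto
      then have "S0 \<union> S1 \<in> ?C" by auto
      then have "\<exists>D\<in>\<D>. uncountable ((S0 \<union> S1) \<inter> D)" by (rule bspec[OF D(4)])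
      then obtain S where S: "S \<in> \<D>" "uncountable ((S0 \<union> S1) \<inter> S)" by auto
      have "concentrated_pair X S (lim S)" using sp[OF S(1)] by (simp add: split_def)
      then have "condensation_points X ((S0 \<union> S1) \<inter> S) \<inter> lim S \<noteq> {}"
        using S(2) by (simp add: concentrated_pair_def)
      then obtain y where y: "y \<in> condensation_points X ((S0 \<union> S1) \<inter> S)" "y \<in> lim S" by auto
      have "(S0 \<union> S1) \<inter> S \<subseteq> C" using R(1) by auto
      then have "y \<in> C" using y(1) condensation_points_closedin[OF C(2)] by auto
      then show ?thesis using y(2) S(1) C(5) unfolding J_def by auto
    qed
    then show "q \<in> X closure_of J" using q YX by (auto simp: in_closure_of)
  qed
  have "\<forall>q\<in>J. \<exists>S. S \<in> \<D> \<and> q \<in> lim S" unfolding J_def by auto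
  from bchoice[OF this] obtain d where d: "\<forall>q\<in>J. d q \<in> \<D> \<and> q \<in> lim (d q)" ..
  let ?D = "d ` J"
  have "le_aleph1 ?D" by (rule le_aleph1_image[OF le_aleph1_subset[OF JY Y(3)]])
  moreover have "countable (S \<inter> S')" if "S \<in> ?D" "S' \<in> ?D" "S \<noteq> S'" for S S'
    using that D(3) d unfolding almost_disjoint_def by auto
  ultimately obtain N where N: "\<forall>S\<in>?D. N S \<subseteq> S" "\<forall>S\<in>?D. countable (S - N S)" "disjoint_family_on N ?D"
    by (rule disjointify)
  define E0 where "E0 = (\<Union>S\<in>?D. red S \<inter> N S)"
  define E1 where "E1 = (\<Union>S\<in>?D. blue S \<inter> N S)"
  have disj: "E0 \<inter> E1 = {}"
  proof (rule ccontr)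
    assume "E0 \<inter> E1 \<noteq> {}"
    then obtain x S S' where x: "S \<in> ?D" "S' \<in> ?D" "x \<in> red S" "x \<in> N S" "x \<in> blue S'" "x \<in> N S'"
      unfolding E0_def E1_def by blast
    have "S = S'" using disjoint_family_onD[OF N(3) x(1,2)] x(4,6) by auto
    moreover have "S \<in> \<D>" using x(1) d by auto
    ultimately show False using sp[of S] x(3,5) by (auto simp: split_def)
  qed
  have J_cl: "J \<subseteq> X closure_of (\<Union>S\<in>?D. c S \<inter> N S)"
    if c: "\<And>S. S \<in> \<D> \<Longrightarrow> lim S \<subseteq> condensation_points X (c S) \<and> c S \<subseteq> S" for c
  proof
    fix q assume q: "q \<in> J"
    then have dq: "d q \<in> \<D>" "q \<in> lim (d q)" "d q \<in> ?D" using d by auto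
    have "\<exists>y. y \<in> (\<Union>S\<in>?D. c S \<inter> N S) \<and> y \<in> W" if W: "q \<in> W \<and> openin X W" for W
    proof -
      have "uncountable (W \<inter> c (d q))"
        using W c[OF dq(1)] dq(2) by (auto simp: condensation_points_def)
      moreover have "countable (d q - N (d q))" using N(2) dq(3) by (rule bspec)
      ultimately have "\<not> W \<inter> c (d q) \<subseteq> d q - N (d q)" by (meson countable_subset)
      then obtain y where "y \<in> W" "y \<in> c (d q)" "y \<in> N (d q)" using c[OF dq(1)] by auto
      then show ?thesis using q by auto
    qed
    then show "q \<in> X closure_of (\<Union>S\<in>?D. c S \<inter> N S)" using q JY YX by (auto simp: in_closure_of)
  qed
  have "lim S \<subseteq> condensation_points X (red S) \<and> red S \<subseteq> S"
    "lim S \<subseteq> condensation_points X (blue S) \<and> blue S \<subseteq> S" if "S \<in> \<D>" for S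
    using sp[OF that] unfolding split_def by blast+
  then have J_cl0: "J \<subseteq> X closure_of E0" and J_cl1: "J \<subseteq> X closure_of E1"
    unfolding E0_def E1_def by (intro J_cl; simp)+
  have Y_cl: "Y \<subseteq> X closure_of E0" "Y \<subseteq> X closure_of E1"
    using \<open>Y \<subseteq> X closure_of J\<close> closure_of_minimal[OF J_cl0 closedin_closure_of]
      closure_of_minimal[OF J_cl1 closedin_closure_of] by auto
  have EY: "E0 \<subseteq> Y" "E1 \<subseteq> Y"
    unfolding E0_def E1_def using sp d by (fastforce simp: split_def)+
  have "E0 = {}"
    using EY Y(1) V(3) Y_cl disj by (intro hereditarily_irresolvableD[OF HI, of E0 E1]) auto
  then have "Y = {}" using Y_cl(1) by simp
  with Y(2) show False by simp
qed

section \<open>Lindeloef generated spaces\<close>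

text \<open>
  If the Lindeloef subspaces near a point are all countable, then an \<open>L\<close>-space is countably tight
  there: the points in closures of countable subsets of \<open>A\<close> form a closed set. As non-empty open
  sets are uncountable, every countable set is then in the closure of a countable set disjoint from
  it. Iterating this gives a sequence of disjoint countable sets, each in the closure of the
  next; those of even and those of odd index form a resolvable subspace.
\<close>

lemma countable_Lindelof_subspaces_contradiction:
  assumes reg: "regular_space X" and HI: "hereditarily_irresolvable X U"
    and U: "openin X U" "U \<noteq> {}" and L: "L_space X"
    and unc: "\<And>W. openin X W \<Longrightarrow> W \<noteq> {} \<Longrightarrow> uncountable W"
    and count: "\<And>P. P \<subseteq> U \<Longrightarrow> Lindelof_space (subtopology X P) \<Longrightarrow> countable P"
  shows False
proof -
  obtain a where "a \<in> U" using U(2) by auto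
  then obtain V C where C: "openin X V" "closedin X C" "a \<in> V" "V \<subseteq> C" "C \<subseteq> U"
    using regular_space_shrink[OF reg U(1)] by metis
  have CX: "C \<subseteq> topspace X" using C(2) by (rule closedin_subset)
  have tight: "\<exists>B\<subseteq>A. countable B \<and> q \<in> X closure_of B" if A: "A \<subseteq> C" and q: "q \<in> X closure_of A" for A q
  proof -
    define F where "F = {x. \<exists>B\<subseteq>A. countable B \<and> x \<in> X closure_of B}"
    have FC: "F \<subseteq> C"
    proof
      fix x assume "x \<in> F"
      then obtain B where "B \<subseteq> A" "x \<in> X closure_of B" unfolding F_def by auto
      then show "x \<in> C" using closure_of_minimal[of B C X] A C(2) by auto
    qed
    have "closedin (subtopology X P) (F \<inter> P)" if P: "P \<subseteq> topspace X" "Lindelof_space (subtopology X P)" for P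
    proof -
      have "closedin (subtopology X P) (C \<inter> P)" using C(2) by (auto simp: closedin_subtopology)
      then have "Lindelof_space (subtopology (subtopology X P) (C \<inter> P))"
        by (rule Lindelof_space_closedin_subtopology[OF P(2)])
      moreover have "P \<inter> (C \<inter> P) = C \<inter> P" by auto
      ultimately have "Lindelof_space (subtopology X (C \<inter> P))" by (simp add: subtopology_subtopology)
      then have "countable (C \<inter> P)" using C(5) by (intro count) auto
      then have FP: "countable (F \<inter> P)" by (rule countable_subset[rotated]) (use FC in auto)
      have "\<forall>x\<in>F \<inter> P. \<exists>B. B \<subseteq> A \<and> countable B \<and> x \<in> X closure_of B" unfolding F_def by auto
      from bchoice[OF this] obtain B where B: "\<forall>x\<in>F \<inter> P. B x \<subseteq> A \<and> countable (B x) \<and> x \<in> X closure_of (B x)" ..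
      let ?B = "\<Union>x\<in>F \<inter> P. B x"
      have "countable ?B" using FP B by (intro countable_UN) auto
      moreover have "?B \<subseteq> A" using B by auto
      ultimately have "X closure_of ?B \<subseteq> F" unfolding F_def by auto
      moreover have "F \<inter> P \<subseteq> X closure_of ?B"
      proof
        fix x assume x: "x \<in> F \<inter> P"
        then have "X closure_of (B x) \<subseteq> X closure_of ?B" by (intro closure_of_mono) auto
        with B x show "x \<in> X closure_of ?B" by auto
      qed
      ultimately have "F \<inter> P = X closure_of ?B \<inter> P" by auto
      then show ?thesis
        unfolding closedin_subtopology by (intro exI[of _ "X closure_of ?B"]) simp
    qed
    then have "closedin X F"
      using L[unfolded L_space_def] FC CX by auto
    moreover have "A \<subseteq> F"
    proof
      fix x assume x: "x \<in> A"
      then have "x \<in> X closure_of {x}" using closure_of_subset[of "{x}" X] A CX by auto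
      then show "x \<in> F" using x unfolding F_def by (auto intro!: exI[of _ "{x}"])
    qed
    ultimately have "X closure_of A \<subseteq> F" by (simp add: closure_of_minimal)
    with q show ?thesis unfolding F_def by auto
  qed
  have "\<exists>B. B \<subseteq> V - E \<and> countable B \<and> E \<subseteq> X closure_of B" if E: "countable E" "E \<subseteq> V" for E
  proof -
    have "\<exists>B. B \<subseteq> V - E \<and> countable B \<and> e \<in> X closure_of B" if e: "e \<in> E" for e
    proof -
      have "\<exists>y. y \<in> V - E \<and> y \<in> W" if W: "e \<in> W \<and> openin X W" for W
      proof -
        have "uncountable (W \<inter> V)" using W e E(2) C(1) by (intro unc) auto
        then have "\<not> W \<inter> V \<subseteq> E" using E(1) by (meson countable_subset)
        then show ?thesis by auto
      qed
      then have "e \<in> X closure_of (V - E)" using e E(2) C(4) CX by (auto simp: in_closure_of)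
      then show ?thesis using tight[of "V - E" e] C(4) by auto
    qed
    then have "\<forall>e\<in>E. \<exists>B. B \<subseteq> V - E \<and> countable B \<and> e \<in> X closure_of B" by auto
    from bchoice[OF this] obtain B where B: "\<forall>e\<in>E. B e \<subseteq> V - E \<and> countable (B e) \<and> e \<in> X closure_of (B e)" ..
    have "E \<subseteq> X closure_of (\<Union>e\<in>E. B e)"
    proof
      fix e assume e: "e \<in> E"
      then have "X closure_of (B e) \<subseteq> X closure_of (\<Union>e\<in>E. B e)" by (intro closure_of_mono) auto
      with B e show "e \<in> X closure_of (\<Union>e\<in>E. B e)" by auto
    qed
    moreover have "countable (\<Union>e\<in>E. B e)" using B E(1) by (intro countable_UN) auto
    moreover have "(\<Union>e\<in>E. B e) \<subseteq> V - E" using B by auto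
    ultimately show ?thesis by auto
  qed
  then have "\<forall>E\<in>{E. countable E \<and> E \<subseteq> V}. \<exists>B. B \<subseteq> V - E \<and> countable B \<and> E \<subseteq> X closure_of B" by auto
  from bchoice[OF this] obtain b where b:
    "\<forall>E\<in>{E. countable E \<and> E \<subseteq> V}. b E \<subseteq> V - E \<and> countable (b E) \<and> E \<subseteq> X closure_of b E" ..
  define E where "E n = ((\<lambda>A. A \<union> b A) ^^ n) {a}" for n
  have E0: "E 0 = {a}" and ES: "E (Suc n) = E n \<union> b (E n)" for n unfolding E_def by auto
  have E: "countable (E n) \<and> E n \<subseteq> V" for n
  proof (induction n)
    case (Suc n)
    then show ?case unfolding ES using b by auto
  qed (use C(3) in \<open>simp add: E0\<close>)
  then have bE: "b (E n) \<subseteq> V - E n" "E n \<subseteq> X closure_of b (E n)" for n using b by auto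
  have mono: "E m \<subseteq> E n" if "m \<le> n" for m n using that by (induction n rule: dec_induct) (auto simp: ES)
  have disj: "b (E m) \<inter> b (E n) = {}" if "m < n" for m n
    using mono[of "Suc m" n] that bE(1)[of n] unfolding ES by auto
  have step: "b (E n) \<subseteq> X closure_of b (E (Suc n))" for n using bE(2)[of "Suc n"] unfolding ES by auto
  define D where "D = (\<Union>n. b (E (2 * n)))"
  define D' where "D' = (\<Union>n. b (E (Suc (2 * n))))"
  have "D \<inter> D' = {}"
  proof (rule ccontr)
    assume "D \<inter> D' \<noteq> {}"
    then obtain x m n where "x \<in> b (E (2 * m))" "x \<in> b (E (Suc (2 * n)))" unfolding D_def D'_def by auto
    moreover have "2 * m < Suc (2 * n) \<or> Suc (2 * n) < 2 * m" by presburger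
    ultimately show False using disj by auto
  qed
  moreover have "D \<subseteq> X closure_of D'"
  proof
    fix x assume "x \<in> D"
    then obtain n where "x \<in> X closure_of b (E (Suc (2 * n)))" using step unfolding D_def by auto
    moreover have "X closure_of b (E (Suc (2 * n))) \<subseteq> X closure_of D'" by (rule closure_of_mono) (auto simp: D'_def)
    ultimately show "x \<in> X closure_of D'" by auto
  qed
  moreover have "D' \<subseteq> X closure_of D"
  proof
    fix x assume "x \<in> D'"
    then obtain n where "x \<in> X closure_of b (E (Suc (Suc (2 * n))))" using step unfolding D'_def by blast
    moreover have "b (E (Suc (Suc (2 * n)))) \<subseteq> D" unfolding D_def by (auto intro!: exI[of _ "Suc n"])
    then have "X closure_of b (E (Suc (Suc (2 * n)))) \<subseteq> X closure_of D" by (rule closure_of_mono)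
    ultimately show "x \<in> X closure_of D" by auto
  qed
  moreover have "D \<subseteq> U" "D' \<subseteq> U" unfolding D_def D'_def using bE(1) C(4,5) by blast+
  ultimately have "D = {}" by (intro hereditarily_irresolvableD[OF HI, of D D']) auto
  then have "b (E 0) = {}" unfolding D_def by (metis (no_types, lifting) SUP_bot_conv(2) UNIV_I mult_0_right)
  with bE(2)[of 0] E0 show False by simp
qed

theorem theorem8:
  fixes X :: "'a topology"
  assumes "regular_space X" and "Hausdorff_space X"
    and "L_space X"
    and "natLeq <o dispersion_character X"
  shows "resolvable X"
proof (rule resolvable_if_not_hereditarily_irresolvable, rule notI)
  fix U assume U: "openin X U" "U \<noteq> {}" and HI: "hereditarily_irresolvable X U"
  have UX: "U \<subseteq> topspace X" using U(1) by (rule openin_subset)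
  with U(2) have "topspace X \<noteq> {}" by auto
  then have unc: "uncountable W" if "openin X W" "W \<noteq> {}" for W
    using assms(4) that by (simp add: natLeq_less_dispersion_character_iff)
  show False
  proof (cases "\<forall>V. openin X V \<and> V \<subseteq> U \<and> V \<noteq> {} \<longrightarrow> (\<exists>T Q. T \<subseteq> V \<and> Q \<subseteq> V \<and> concentrated_pair X T Q)")
    case True
    then show False
      by (intro concentrated_pairs_dense_contradiction[OF assms(1) HI U]) simp
  next
    case False
    then obtain V where V: "openin X V" "V \<subseteq> U" "V \<noteq> {}"
      and none: "\<not> (\<exists>T Q. T \<subseteq> V \<and> Q \<subseteq> V \<and> concentrated_pair X T Q)" by auto
    have "countable P" if P: "P \<subseteq> V" "Lindelof_space (subtopology X P)" for P
    proof (rule ccontr)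
      assume "uncountable P"
      moreover have "P \<subseteq> U" "P \<subseteq> topspace X" using P(1) V(2) UX by auto
      ultimately obtain T Q where "T \<subseteq> P" "Q \<subseteq> P" "concentrated_pair X T Q"
        using condensing_imp_concentrated[OF assms(1) HI UX] Lindelof_imp_condensing[OF _ P(2)] by metis
      with P(1) none show False by (meson subset_trans)
    qed
    moreover have "hereditarily_irresolvable X V"
      using HI V(2) unfolding hereditarily_irresolvable_def by (meson subset_trans)
    ultimately show False
      using countable_Lindelof_subspaces_contradiction[OF assms(1) _ V(1,3) assms(3) unc] by metis
  qed
qed

end
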